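(* Let $N\in\mathbb{Z}_+$, $0\le p_0<q_0\le 1$, $0<\delta<\rho<1$ with $\delta<1/2$. There is a $\rho$-replicable algorithm for the $N$-Coin Problem using $O\left(\frac{N}{(q_0 - p_0)^2 \rho^2} \log^3 \frac{N}{\delta}\right)$ vector samples (or $O\left(\frac{N^2}{(q_0 - p_0)^2 \rho^2} \log^3 \frac{N}{\delta}\right)$ coordinate samples).
   Context: $N$-Coin Problem (parameters $p_0<q_0$, $\delta$): given sample access to $N$ (possibly correlated) coins with unknown biases $p_1,\dots,p_N\in[0,1]$, output a set $\mathcal{O}\subset[N]$ such that $\Pr\left(\exists i:\ (p_i\le p_0 \text{ and } i\in\mathcal{O})\text{ or }(p_i\ge q_0\text{ and }i\notin\mathcal{O})\right)<\delta$. A vector sample is one simultaneous flip of all $N$ coins (a vector in $\{0,1\}^N$); a coordinate sample is a flip of one chosen coin. Replicability: an algorithm $\mathcal{A}$ with internal randomness $r$ is $\rho$-replicable if for all input distributions $\mathcal{D}$, $\Pr_{r,S,S'}(\mathcal{A}(S;r)=\mathcal{A}(S';r))\ge 1-\rho$, where $S,S'$ are independent sets of i.i.d. samples from $\mathcal{D}$ and $r$ is shared. $O(\cdot)$ hides an absolute constant. *)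

theory Defs
  imports "HOL-Probability.Probability"
begin

text \<open>
  The coins are numbered from \<open>0\<close> to \<open>N - 1\<close>. Their joint law, which may be correlated, is a
  distribution on \<open>{0,1}\<^sup>N\<close>; outcomes are Boolean lists of length \<open>N\<close>.
\<close>

definition coin_distribution :: "nat \<Rightarrow> bool list pmf \<Rightarrow> bool" where
  "coin_distribution N D \<longleftrightarrow> (\<forall>x\<in>set_pmf D. length x = N)"

definition bias :: "bool list pmf \<Rightarrow> nat \<Rightarrow> real" where
  "bias D i = measure_pmf.prob D {x. x ! i}"

text \<open>
  A randomized algorithm is a map \<open>A r S\<close>, deterministic in the random seed \<open>r\<close> and the list \<open>S\<close> of
  vector samples. The seed is drawn from a probability space \<open>R\<close>. Without the measurability
  condition the events below could be non-measurable and get the junk value 0 from \<^const>\<open>measure\<close>.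
\<close>

definition vector_algorithm ::
    "nat \<Rightarrow> 'r measure \<Rightarrow> ('r \<Rightarrow> bool list list \<Rightarrow> nat set) \<Rightarrow> bool" where
  "vector_algorithm N R A \<longleftrightarrow>
     prob_space R \<and> (\<forall>S. (\<lambda>r. A r S) \<in> R \<rightarrow>\<^sub>M count_space (Pow {..<N}))"

text \<open>
  In the coordinate model the algorithm chooses the next coin from the seed and the flips seen so far
  (\<open>q r h\<close>) and sees only the flip of that coin. A flip of coin \<open>i\<close> is the \<open>i\<close>-th entry of a fresh
  sample from \<open>D\<close>, the other entries of which are discarded unseen: each element of the list \<open>S\<close>
  below accounts for exactly one coordinate sample.
\<close>

fun coordinate_flips :: "(bool list \<Rightarrow> nat) \<Rightarrow> bool list \<Rightarrow> bool list list \<Rightarrow> bool list" where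
  "coordinate_flips q h [] = h"
| "coordinate_flips q h (x # S) = coordinate_flips q (h @ [x ! q h]) S"

definition coordinate_run ::
    "('r \<Rightarrow> bool list \<Rightarrow> nat) \<Rightarrow> ('r \<Rightarrow> bool list \<Rightarrow> nat set) \<Rightarrow> 'r \<Rightarrow> bool list list \<Rightarrow> nat set" where
  "coordinate_run q f r S = f r (coordinate_flips (q r) [] S)"

definition coordinate_algorithm ::
    "nat \<Rightarrow> 'r measure \<Rightarrow> ('r \<Rightarrow> bool list \<Rightarrow> nat) \<Rightarrow> ('r \<Rightarrow> bool list \<Rightarrow> nat set) \<Rightarrow> bool" where
  "coordinate_algorithm N R q f \<longleftrightarrow>
     prob_space R \<and>
     (\<forall>h. (\<lambda>r. q r h) \<in> R \<rightarrow>\<^sub>M count_space {..<N}) \<and>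
     (\<forall>h. (\<lambda>r. f r h) \<in> R \<rightarrow>\<^sub>M count_space (Pow {..<N}))"

definition coin_error :: "nat \<Rightarrow> real \<Rightarrow> real \<Rightarrow> bool list pmf \<Rightarrow> nat set \<Rightarrow> bool" where
  "coin_error N p\<^sub>0 q\<^sub>0 D O' \<longleftrightarrow>
     (\<exists>i<N. (bias D i \<le> p\<^sub>0 \<and> i \<in> O') \<or> (bias D i \<ge> q\<^sub>0 \<and> i \<notin> O'))"

definition solves_coin_problem ::
    "nat \<Rightarrow> real \<Rightarrow> real \<Rightarrow> real \<Rightarrow> nat \<Rightarrow> 'r measure \<Rightarrow> ('r \<Rightarrow> bool list list \<Rightarrow> nat set) \<Rightarrow> bool" where
  "solves_coin_problem N p\<^sub>0 q\<^sub>0 \<delta> m R A \<longleftrightarrow>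
     (\<forall>D. coin_distribution N D \<longrightarrow>
        measure (R \<Otimes>\<^sub>M replicate_pmf m D)
          {(r, S) \<in> space (R \<Otimes>\<^sub>M replicate_pmf m D). coin_error N p\<^sub>0 q\<^sub>0 D (A r S)} < \<delta>)"

definition replicable ::
    "nat \<Rightarrow> real \<Rightarrow> nat \<Rightarrow> 'r measure \<Rightarrow> ('r \<Rightarrow> bool list list \<Rightarrow> nat set) \<Rightarrow> bool" where
  "replicable N \<rho> m R A \<longleftrightarrow>
     (\<forall>D. coin_distribution N D \<longrightarrow>
        measure (R \<Otimes>\<^sub>M (replicate_pmf m D \<Otimes>\<^sub>M replicate_pmf m D))
          {(r, S, S') \<in> space (R \<Otimes>\<^sub>M (replicate_pmf m D \<Otimes>\<^sub>M replicate_pmf m D)). A r S = A r S'}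
        \<ge> 1 - \<rho>)"

text \<open>Sanity checks: the events above are measurable, for both kinds of algorithms.\<close>

lemma vector_algorithm_events:
  assumes "vector_algorithm N R A"
  shows "{(r, S) \<in> space (R \<Otimes>\<^sub>M measure_pmf P). E (A r S)} \<in> sets (R \<Otimes>\<^sub>M measure_pmf P)"
    and "{(r, S, S') \<in> space (R \<Otimes>\<^sub>M (measure_pmf P \<Otimes>\<^sub>M measure_pmf Q)). A r S = A r S'}
           \<in> sets (R \<Otimes>\<^sub>M (measure_pmf P \<Otimes>\<^sub>M measure_pmf Q))"
proof -
  have ev: "{r \<in> space R. E (A r S)} \<in> sets R" for S E
  proof -
    have "(\<lambda>r. A r S) -` {X \<in> Pow {..<N}. E X} \<inter> space R \<in> sets R"
      using assms unfolding vector_algorithm_def by (intro measurable_sets) auto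
    moreover have "A r S \<in> Pow {..<N}" if "r \<in> space R" for r
      using assms that measurable_space[of "\<lambda>r. A r S" R "count_space (Pow {..<N})" r]
      unfolding vector_algorithm_def by (auto simp del: Pow_iff)
    ultimately show ?thesis
      by (elim back_subst[of "\<lambda>X. X \<in> sets R"]) auto
  qed
  have "{(r, S) \<in> space (R \<Otimes>\<^sub>M measure_pmf P). E (A r S)} =
      (\<Union>S. {r \<in> space R. E (A r S)} \<times> {S})"
    by (auto simp: space_pair_measure)
  also have "\<dots> \<in> sets (R \<Otimes>\<^sub>M measure_pmf P)"
    by (intro sets.countable_UN'' pair_measureI ev) auto
  finally show "{(r, S) \<in> space (R \<Otimes>\<^sub>M measure_pmf P). E (A r S)}
      \<in> sets (R \<Otimes>\<^sub>M measure_pmf P)" .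
  have eq: "{r \<in> space R. A r S = A r S'} \<in> sets R" for S S'
  proof -
    have "A r S \<in> Pow {..<N}" if "r \<in> space R" for r
      using assms that measurable_space[of "\<lambda>r. A r S" R "count_space (Pow {..<N})" r]
      unfolding vector_algorithm_def by (auto simp del: Pow_iff)
    then have "{r \<in> space R. A r S = A r S'} =
        (\<Union>X\<in>Pow {..<N}. {r \<in> space R. A r S = X} \<inter> {r \<in> space R. A r S' = X})"
      by auto
    also have "\<dots> \<in> sets R"
      by (intro sets.finite_UN sets.Int ev[of "\<lambda>Y. Y = _"]) auto
    finally show ?thesis .
  qed
  have "{(r, S, S') \<in> space (R \<Otimes>\<^sub>M (measure_pmf P \<Otimes>\<^sub>M measure_pmf Q)). A r S = A r S'} =
      (\<Union>S. \<Union>S'. {r \<in> space R. A r S = A r S'} \<times> ({S} \<times> {S'}))"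
    by (auto simp: space_pair_measure)
  also have "\<dots> \<in> sets (R \<Otimes>\<^sub>M (measure_pmf P \<Otimes>\<^sub>M measure_pmf Q))"
    by (intro sets.countable_UN'' pair_measureI eq) auto
  finally show "{(r, S, S') \<in> space (R \<Otimes>\<^sub>M (measure_pmf P \<Otimes>\<^sub>M measure_pmf Q)). A r S = A r S'}
      \<in> sets (R \<Otimes>\<^sub>M (measure_pmf P \<Otimes>\<^sub>M measure_pmf Q))" .
qed

lemma coordinate_algorithm_imp_vector_algorithm:
  assumes "coordinate_algorithm N R q f"
  shows "vector_algorithm N R (coordinate_run q f)"
proof -
  have "(\<lambda>r. q r h) \<in> R \<rightarrow>\<^sub>M count_space {..<N}" for h
    using assms unfolding coordinate_algorithm_def by blast
  then have q: "(\<lambda>r. q r h) \<in> R \<rightarrow>\<^sub>M count_space UNIV" for h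
    by (rule measurable_compose) simp
  have "(\<lambda>r. coordinate_flips (q r) (h r) S) \<in> R \<rightarrow>\<^sub>M count_space UNIV"
    if "h \<in> R \<rightarrow>\<^sub>M count_space UNIV" for h S
    using that
  proof (induction S arbitrary: h)
    case (Cons x S)
    have "(\<lambda>r. q r (h r)) \<in> R \<rightarrow>\<^sub>M count_space UNIV"
      by (rule measurable_compose_countable[OF q Cons.prems])
    then have "(\<lambda>r. (h r, q r (h r))) \<in> R \<rightarrow>\<^sub>M count_space UNIV \<Otimes>\<^sub>M count_space UNIV"
      using Cons.prems by (intro measurable_Pair)
    then have "(\<lambda>r. (h r, q r (h r))) \<in> R \<rightarrow>\<^sub>M count_space UNIV"
      by (simp add: pair_measure_countable)
    from measurable_compose[OF this, of "\<lambda>(h, i). h @ [x ! i]" "count_space UNIV"]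
    have "(\<lambda>r. h r @ [x ! q r (h r)]) \<in> R \<rightarrow>\<^sub>M count_space UNIV"
      by simp
    from Cons.IH[OF this] show ?case by simp
  qed simp
  from this[of "\<lambda>_. []"]
  have flips: "(\<lambda>r. coordinate_flips (q r) [] S) \<in> R \<rightarrow>\<^sub>M count_space UNIV" for S
    by simp
  have f: "(\<lambda>r. f r h) \<in> R \<rightarrow>\<^sub>M count_space (Pow {..<N})" for h
    using assms unfolding coordinate_algorithm_def by blast
  have "(\<lambda>r. f r (coordinate_flips (q r) [] S)) \<in> R \<rightarrow>\<^sub>M count_space (Pow {..<N})" for S
    by (rule measurable_compose_countable[where f = "\<lambda>h r. f r h", OF f flips])
  then show ?thesis
    using assms unfolding vector_algorithm_def coordinate_algorithm_def coordinate_run_def by simp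
qed

end

theory Submission
  imports Defs
begin

text \<open>
  Estimate all biases and round the estimate to a random set: coin \<open>i\<close> is included independently with
  probability \<open>sin\<^sup>2 \<theta>\<^sub>i\<close>, where \<open>\<theta>\<^sub>i\<close> moves linearly from \<open>0\<close> to \<open>\<pi> / 2\<close> as the estimate moves across the
  middle half of \<open>[p\<^sub>0, q\<^sub>0]\<close>. Accurate estimates never lead to an error, since the decision is then
  forced for coins outside \<open>(p\<^sub>0, q\<^sub>0)\<close>. Hellinger distance tensorises, so two estimates yield product
  distributions whose total variation distance is at most a constant times the Euclidean distance of the
  estimates divided by \<open>q\<^sub>0 - p\<^sub>0\<close>, in expectation \<open>O((N / m)\<^sup>1\<^sup>/\<^sup>2 / (q\<^sub>0 - p\<^sub>0))\<close>. Correlated sampling with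
  shared randomness makes the two outputs differ with probability proportional to that distance, so
  \<open>m\<close> of order \<open>N / ((q\<^sub>0 - p\<^sub>0)\<^sup>2 \<rho>\<^sup>2)\<close> samples per coin suffice. The correlated sampling is discrete: the
  probabilities are rounded to multiples of \<open>1 / L\<close>, the seed is a uniform random order of all pairs of a
  set \<open>X\<close> and a level \<open>h < L\<close>, and the output is the set of the first pair below the graph.
\<close>

section \<open>Correlated sampling\<close>

text \<open>A uniformly random order of \<open>U\<close>. Ranks are stored as reals only to give the
  seed the fixed type \<open>nat \<Rightarrow> real\<close> for every \<open>N\<close>.\<close>

definition rank_seed :: "nat set \<Rightarrow> (nat \<Rightarrow> real) pmf" where
  "rank_seed U = map_pmf (\<lambda>\<pi>. real \<circ> \<pi>) (pmf_of_set {\<pi>. \<pi> permutes U})"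

lemma arg_min_on_eqI:
  fixes f :: "'a \<Rightarrow> 'b :: linorder"
  assumes "finite S" "y \<in> S" "inj_on f S" "\<And>x. x \<in> S \<Longrightarrow> f y \<le> f x"
  shows "arg_min_on f S = y"
proof -
  have "arg_min_on f S \<in> S" "f (arg_min_on f S) \<le> f y"
    using assms(1,2) arg_min_if_finite(1)[of S f] arg_min_least[of S y f] by auto
  moreover from this have "f y \<le> f (arg_min_on f S)" using assms(4) by blast
  ultimately show ?thesis using assms(2,3) by (metis inj_onD antisym)
qed

text \<open>By symmetry: for \<open>a\<close>, \<open>b\<close> in \<open>V\<close>, composing with
  the transposition of \<open>a\<close> and \<open>b\<close> injects the orders whose minimum over
  \<open>V\<close> is at \<open>a\<close> into those whose minimum is at \<open>b\<close>. Hence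
  every element of \<open>V\<close> is the minimiser of the same number \<open>c v\<close> of
  orders.\<close>

lemma prob_arg_min_rank_seed:
  assumes "finite U" "V \<subseteq> U" "V \<noteq> {}" "B \<subseteq> V"
  shows "measure_pmf.prob (rank_seed U) {r. arg_min_on r V \<in> B} = card B / card V"
proof -
  define P where "P = {\<pi>. \<pi> permutes U}"
  define c where "c a = card {\<pi>\<in>P. arg_min_on (real \<circ> \<pi>) V = a}" for a
  have fV: "finite V" and fP: "finite P" and P0: "P \<noteq> {}"
    using assms finite_subset finite_permutations permutes_id unfolding P_def by blast+
  have le: "c a \<le> c b" if "a \<in> V" "b \<in> V" for a b
    unfolding c_def
  proof (rule card_inj_on_le[where f = "\<lambda>\<pi>. \<pi> \<circ> Transposition.transpose a b"])
    let ?t = "Transposition.transpose a b"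
    show "inj_on (\<lambda>\<pi>. \<pi> \<circ> ?t) {\<pi> \<in> P. arg_min_on (real \<circ> \<pi>) V = a}"
    proof (rule inj_onI)
      fix f g assume "f \<circ> ?t = g \<circ> ?t"
      then have "(f \<circ> ?t) \<circ> ?t = (g \<circ> ?t) \<circ> ?t" by simp
      then show "f = g" by (simp add: comp_assoc)
    qed
    show "(\<lambda>\<pi>. \<pi> \<circ> ?t) ` {\<pi> \<in> P. arg_min_on (real \<circ> \<pi>) V = a}
        \<subseteq> {\<pi> \<in> P. arg_min_on (real \<circ> \<pi>) V = b}"
    proof (rule image_subsetI)
      fix \<pi> assume "\<pi> \<in> {\<pi> \<in> P. arg_min_on (real \<circ> \<pi>) V = a}"
      then have \<pi>: "\<pi> \<in> P" and a: "arg_min_on (real \<circ> \<pi>) V = a" by auto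
      have t: "?t permutes U" using that assms(2) by (intro permutes_swap_id) auto
      have P: "\<pi> \<circ> ?t \<in> P" using \<pi> t permutes_compose unfolding P_def by blast
      then have "inj (\<pi> \<circ> ?t)" unfolding P_def using permutes_inj by blast
      then have "inj (real \<circ> (\<pi> \<circ> ?t))" by (rule inj_compose[OF inj_of_nat])
      then have "inj_on (real \<circ> (\<pi> \<circ> ?t)) V" by (rule inj_on_subset) simp
      moreover have "\<pi> a \<le> \<pi> (?t x)" if x: "x \<in> V" for x
      proof -
        have "?t x \<in> V" using x \<open>a \<in> V\<close> \<open>b \<in> V\<close> by (auto simp: Transposition.transpose_def)
        then show ?thesis using arg_min_least[OF fV assms(3), of "?t x" "real \<circ> \<pi>"] a by simp
      qed
      ultimately have "arg_min_on (real \<circ> (\<pi> \<circ> ?t)) V = b"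
        by (intro arg_min_on_eqI[OF fV \<open>b \<in> V\<close>]) simp_all
      with P show "\<pi> \<circ> ?t \<in> {\<pi> \<in> P. arg_min_on (real \<circ> \<pi>) V = b}" by simp
    qed
  qed (use fP in simp)
  have sum_c: "card {\<pi>\<in>P. arg_min_on (real \<circ> \<pi>) V \<in> X} = (\<Sum>a\<in>X. c a)" if "X \<subseteq> V" for X
  proof -
    have "{\<pi>\<in>P. arg_min_on (real \<circ> \<pi>) V \<in> X} = (\<Union>a\<in>X. {\<pi>\<in>P. arg_min_on (real \<circ> \<pi>) V = a})"
      by auto
    then show ?thesis
      unfolding c_def using fP finite_subset[OF that fV]
      by (subst card_UN_disjoint[symmetric]) auto
  qed
  obtain v where v: "v \<in> V" using assms(3) by blast
  have c: "c a = c v" if "a \<in> V" for a using le[OF that v] le[OF v that] by simp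
  have cB: "card {\<pi>\<in>P. arg_min_on (real \<circ> \<pi>) V \<in> B} = card B * c v"
    using sum_c[OF assms(4)] c assms(4) by (simp add: subset_iff)
  have "card P = card {\<pi>\<in>P. arg_min_on (real \<circ> \<pi>) V \<in> V}"
    by (simp add: arg_min_if_finite(1)[OF fV assms(3)])
  also have "\<dots> = card V * c v" using sum_c[OF subset_refl] c by simp
  finally have cP: "card P = card V * c v" .
  then have "c v > 0" using fP P0 by (metis card_gt_0_iff mult_is_0 neq0_conv)
  have "measure_pmf.prob (rank_seed U) {r. arg_min_on r V \<in> B}
      = card (P \<inter> {\<pi>. arg_min_on (real \<circ> \<pi>) V \<in> B}) / card P"
    unfolding rank_seed_def P_def[symmetric]
    by (simp add: measure_pmf_of_set[OF P0 fP] vimage_def)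
  also have "\<dots> = card B / card V"
    unfolding Int_def mem_Collect_eq using cB cP \<open>c v > 0\<close> by simp
  finally show ?thesis .
qed

text \<open>
  Min-wise hashing: the two minima agree whenever the minimum over the union lies in the intersection.
\<close>
lemma prob_arg_min_neq_le:
  assumes "finite U" "V \<subseteq> U" "W \<subseteq> U" "V \<noteq> {}" "W \<noteq> {}"
  shows "measure_pmf.prob (rank_seed U) {r. arg_min_on r V \<noteq> arg_min_on r W}
    \<le> card ((V - W) \<union> (W - V)) / card (V \<union> W)"
proof -
  \<comment> \<open>Ties would leave \<open>arg_min_on\<close> to an arbitrary choice; seeds in the
    support have none.\<close>
  have inj: "inj r" if r: "r \<in> set_pmf (rank_seed U)" for r
  proof -
    have "{\<pi>. \<pi> permutes U} \<noteq> {}" using permutes_id by blast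
    with r obtain \<pi> where "\<pi> permutes U" "r = real \<circ> \<pi>"
      using finite_permutations[OF assms(1)] unfolding rank_seed_def by (auto simp: set_pmf_of_set)
    then show ?thesis using permutes_inj by (auto intro!: inj_compose)
  qed
  have fin: "finite V" "finite W" using assms finite_subset by auto
  have "arg_min_on r V = arg_min_on r W"
    if "inj r" "arg_min_on r (V \<union> W) \<in> V \<inter> W" for r :: "nat \<Rightarrow> real"
  proof -
    have "r (arg_min_on r (V \<union> W)) \<le> r x" if "x \<in> V \<union> W" for x
      using that fin by (intro arg_min_least) auto
    then have "arg_min_on r V = arg_min_on r (V \<union> W)" "arg_min_on r W = arg_min_on r (V \<union> W)"
      using that fin by (auto intro!: arg_min_on_eqI inj_on_subset[OF \<open>inj r\<close>])
    then show ?thesis by simp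
  qed
  moreover have "arg_min_on r (V \<union> W) \<in> V \<union> W" for r :: "nat \<Rightarrow> real"
    using fin assms by (intro arg_min_if_finite) auto
  ultimately have "measure_pmf.prob (rank_seed U) {r. arg_min_on r V \<noteq> arg_min_on r W}
      \<le> measure_pmf.prob (rank_seed U) {r. arg_min_on r (V \<union> W) \<in> (V - W) \<union> (W - V)}"
    using inj by (intro measure_pmf.finite_measure_mono_AE) (auto simp: AE_measure_pmf_iff)
  also have "\<dots> = card ((V - W) \<union> (W - V)) / card (V \<union> W)"
    using assms by (intro prob_arg_min_rank_seed) auto
  finally show ?thesis .
qed

section \<open>Sampling a subset by ranking the points below a weight function\<close>

definition subgraph_code :: "nat set \<Rightarrow> (nat set \<Rightarrow> nat) \<Rightarrow> nat set" where
  "subgraph_code I w =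
     (\<lambda>(X, h). prod_encode (set_encode X, h)) ` (SIGMA X : Pow I. {..<w X})"

text \<open>The points \<open>(X, h)\<close> with \<open>h < w X\<close> are coded as naturals so
  that the seed can rank them. Each \<open>X\<close> owns \<open>w X\<close> of them, so under a
  uniform order of a superset it is picked with probability proportional to
  \<open>w X\<close>.\<close>

definition pick :: "nat set \<Rightarrow> (nat set \<Rightarrow> nat) \<Rightarrow> (nat \<Rightarrow> real) \<Rightarrow> nat set" where
  "pick I w r = set_decode (fst (prod_decode (arg_min_on r (subgraph_code I w))))"

lemma inj_on_code:
  assumes "finite I"
  shows "inj_on (\<lambda>(X, h). prod_encode (set_encode X, h)) (Pow I \<times> UNIV)"
  by (rule inj_onI) (auto simp: set_encode_eq finite_subset[OF _ assms])

text \<open>The minimiser is itself a point below the graph, so for every seed whatsoever the output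
  has positive weight. This later makes forced decisions certain and not merely likely.\<close>

lemma pick_props:
  assumes "finite I" "(\<Sum>X\<in>Pow I. w X) > 0"
  shows "subgraph_code I w \<noteq> {}" "pick I w r \<subseteq> I" "w (pick I w r) > 0"
proof -
  have "\<exists>X\<in>Pow I. w X \<noteq> 0" by (rule ccontr) (use assms(2) in simp)
  then obtain X where "X \<in> Pow I" "0 < w X" by auto
  then have "(X, 0) \<in> (SIGMA X : Pow I. {..<w X})" by simp
  then show ne: "subgraph_code I w \<noteq> {}" unfolding subgraph_code_def by blast
  have "finite (subgraph_code I w)" unfolding subgraph_code_def using assms(1) by auto
  then have "arg_min_on r (subgraph_code I w) \<in> subgraph_code I w"
    using ne by (rule arg_min_if_finite(1))
  moreover have "\<exists>X h. X \<subseteq> I \<and> h < w X \<and> u = prod_encode (set_encode X, h)"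
    if "u \<in> subgraph_code I w" for u
    using that unfolding subgraph_code_def by auto
  ultimately obtain X h where "X \<subseteq> I" "h < w X"
      "arg_min_on r (subgraph_code I w) = prod_encode (set_encode X, h)"
    by blast
  moreover from this have "pick I w r = X"
    unfolding pick_def using finite_subset[OF _ assms(1)] by (simp add: set_encode_inverse)
  ultimately show "pick I w r \<subseteq> I" "w (pick I w r) > 0" by auto
qed

text \<open>All weights bounded by \<open>L\<close> share the ambient set of height
  \<open>L\<close>, hence one seed. The symmetric difference of two subgraphs has
  \<open>\<bar>w X - w' X\<bar>\<close> points over each \<open>X\<close>, and their union has at
  least as many points as the first, so min-wise hashing gives the ratio.\<close>

lemma prob_pick_neq_le:
  assumes "finite I" "(\<Sum>X\<in>Pow I. w X) > 0" "(\<Sum>X\<in>Pow I. w' X) > 0"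
    and "\<And>X. X \<subseteq> I \<Longrightarrow> w X \<le> L" "\<And>X. X \<subseteq> I \<Longrightarrow> w' X \<le> L"
  shows "measure_pmf.prob (rank_seed (subgraph_code I (\<lambda>_. L))) {r. pick I w r \<noteq> pick I w' r}
    \<le> (\<Sum>X\<in>Pow I. \<bar>real (w X) - real (w' X)\<bar>) / (\<Sum>X\<in>Pow I. real (w X))"
proof -
  let ?U = "subgraph_code I (\<lambda>_. L)" and ?V = "subgraph_code I w" and ?W = "subgraph_code I w'"
  let ?e = "\<lambda>(X, h). prod_encode (set_encode X, h)"
  let ?S = "\<lambda>w. SIGMA X : Pow I. {..<w X}"
  have finU: "finite ?U" unfolding subgraph_code_def using assms(1) by auto
  have sub: "?V \<subseteq> ?U" "?W \<subseteq> ?U"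
    unfolding subgraph_code_def
    by (intro image_mono Sigma_mono subset_refl; use assms(4,5) in simp)+
  note inj = inj_on_code[OF assms(1)]
  have card_S: "card (?e ` (SIGMA X : Pow I. A X)) = (\<Sum>X\<in>Pow I. card (A X))"
    if "\<And>X. finite (A X)" for A :: "nat set \<Rightarrow> nat set"
  proof -
    have "card (?e ` (SIGMA X : Pow I. A X)) = card (SIGMA X : Pow I. A X)"
      by (intro card_image inj_on_subset[OF inj]) auto
    then show ?thesis using assms(1) that by (simp add: card_SigmaI)
  qed
  have D: "?e ` ?S u - ?e ` ?S u' = ?e ` (SIGMA X : Pow I. {..<u X} - {..<u' X})" for u u'
  proof -
    have "?e ` ?S u - ?e ` ?S u' = ?e ` (?S u - ?S u')"
      by (rule inj_on_image_set_diff[OF inj, symmetric]) auto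
    also have "?S u - ?S u' = (SIGMA X : Pow I. {..<u X} - {..<u' X})" by auto
    finally show ?thesis .
  qed
  have cD: "card (subgraph_code I u - subgraph_code I u') = (\<Sum>X\<in>Pow I. u X - u' X)" for u u'
    unfolding subgraph_code_def D by (subst card_S) (auto intro!: sum.cong simp: lessThan_minus_lessThan)
  have "card ((?V - ?W) \<union> (?W - ?V)) = card (?V - ?W) + card (?W - ?V)"
    using finite_subset[OF _ finU] sub by (intro card_Un_disjoint) auto
  \<comment> \<open>Subtraction in \<open>cD\<close> is truncated: over each \<open>X\<close> at
    most one of the two differences is nonzero, and their sum is the absolute difference.\<close>
  then have "real (card ((?V - ?W) \<union> (?W - ?V))) = (\<Sum>X\<in>Pow I. \<bar>real (w X) - real (w' X)\<bar>)"
    unfolding cD sum.distrib[symmetric] of_nat_sum by (auto simp: sum.distrib[symmetric] intro!: sum.cong)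
  moreover have "real (card (?V \<union> ?W)) \<ge> (\<Sum>X\<in>Pow I. real (w X))"
  proof -
    have "card ?V = (\<Sum>X\<in>Pow I. w X)"
      unfolding subgraph_code_def by (subst card_S) auto
    moreover have "card ?V \<le> card (?V \<union> ?W)"
      using finite_subset[OF _ finU] sub by (intro card_mono) auto
    ultimately show ?thesis by (metis of_nat_le_iff of_nat_sum)
  qed
  moreover have "(\<Sum>X\<in>Pow I. real (w X)) > 0" using assms(2) by (metis of_nat_0_less_iff of_nat_sum)
  ultimately have le: "card ((?V - ?W) \<union> (?W - ?V)) / card (?V \<union> ?W)
      \<le> (\<Sum>X\<in>Pow I. \<bar>real (w X) - real (w' X)\<bar>) / (\<Sum>X\<in>Pow I. real (w X))"
    by (intro frac_le) (auto intro: sum_nonneg)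
  have "measure_pmf.prob (rank_seed ?U) {r. pick I w r \<noteq> pick I w' r}
      \<le> measure_pmf.prob (rank_seed ?U) {r. arg_min_on r ?V \<noteq> arg_min_on r ?W}"
    by (intro measure_pmf.finite_measure_mono) (auto simp: pick_def)
  also have "\<dots> \<le> card ((?V - ?W) \<union> (?W - ?V)) / card (?V \<union> ?W)"
    using pick_props(1)[OF assms(1)] assms(2,3) finU sub by (intro prob_arg_min_neq_le) auto
  finally show ?thesis using le by simp
qed

section \<open>Rounding to a product distribution\<close>

lemma one_minus_prod_le_sum:
  fixes f :: "'a \<Rightarrow> real"
  assumes "finite I" "\<And>i. i \<in> I \<Longrightarrow> 0 \<le> f i" "\<And>i. i \<in> I \<Longrightarrow> f i \<le> 1"
  shows "1 - (\<Prod>i\<in>I. f i) \<le> (\<Sum>i\<in>I. 1 - f i)"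
  using assms
proof (induction I rule: finite_induct)
  case (insert i I)
  have IH: "1 - (\<Prod>i\<in>I. f i) \<le> (\<Sum>i\<in>I. 1 - f i)" using insert by auto
  have "f i * (1 - (\<Prod>i\<in>I. f i)) \<le> 1 * (1 - (\<Prod>i\<in>I. f i))"
    using insert.prems by (intro mult_right_mono) (auto intro!: prod_le_1)
  then have "1 - f i * (\<Prod>i\<in>I. f i) \<le> 1 - f i + (1 - (\<Prod>i\<in>I. f i))"
    by (simp add: algebra_simps)
  then show ?case using IH insert.hyps by simp
qed simp

lemma one_minus_cos_le: "1 - cos x \<le> x\<^sup>2 / 2" for x :: real
proof -
  have "(sin (x / 2))\<^sup>2 \<le> (x / 2)\<^sup>2"
    using abs_sin_x_le_abs_x[of "x / 2"] by (simp only: abs_le_square_iff)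
  moreover have "cos x = 1 - 2 * (sin (x / 2))\<^sup>2" using cos_double_sin[of "x / 2"] by simp
  ultimately show ?thesis by (simp add: power_divide)
qed

text \<open>
  The square root of the probability of \<open>X\<close> if each \<open>i\<close> is included independently with probability
  \<open>sin\<^sup>2 (\<theta> i)\<close>. With this parametrisation the Hellinger affinity of two such distributions is a
  product of cosines of differences.
\<close>
definition root_weight :: "nat set \<Rightarrow> (nat \<Rightarrow> real) \<Rightarrow> nat set \<Rightarrow> real" where
  "root_weight I \<theta> X = (\<Prod>i\<in>X. sin (\<theta> i)) * (\<Prod>i\<in>I - X. cos (\<theta> i))"

text \<open>Write each cosine of a difference as a sum of two products; expanding the product over
  \<open>I\<close> gives one term for each set \<open>X\<close> of indices at which the sine term is
  chosen.\<close>

lemma sum_root_weight_mult: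
  assumes "finite I"
  shows "(\<Sum>X\<in>Pow I. root_weight I \<theta> X * root_weight I \<phi> X) = (\<Prod>i\<in>I. cos (\<theta> i - \<phi> i))"
proof -
  have "(\<Prod>i\<in>I. cos (\<theta> i - \<phi> i)) = (\<Prod>i\<in>I. sin (\<theta> i) * sin (\<phi> i) + cos (\<theta> i) * cos (\<phi> i))"
    by (simp add: cos_diff add.commute)
  also have "\<dots> = (\<Sum>X\<in>Pow I. root_weight I \<theta> X * root_weight I \<phi> X)"
    unfolding prod_add[OF assms] root_weight_def by (simp add: prod.distrib mult_ac)
  finally show ?thesis ..
qed

lemma sum_root_weight_square:
  assumes "finite I"
  shows "(\<Sum>X\<in>Pow I. (root_weight I \<theta> X)\<^sup>2) = 1"
  using sum_root_weight_mult[OF assms, of \<theta> \<theta>] by (simp add: power2_eq_square)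

text \<open>The squared differences of the root weights sum to 2 minus twice the affinity, and the
  affinity is at least 1 minus half the squared distance of the angles. The parameter
  \<open>\<eta>\<close> is left free, to be balanced against \<open>\<rho>\<close> later.\<close>

lemma sum_abs_root_weight_diff_le:
  assumes "finite I" "\<eta> > 0" "\<And>i. i \<in> I \<Longrightarrow> \<theta> i \<in> {0..pi/2}" "\<And>i. i \<in> I \<Longrightarrow> \<phi> i \<in> {0..pi/2}"
  shows "(\<Sum>X\<in>Pow I. \<bar>(root_weight I \<theta> X)\<^sup>2 - (root_weight I \<phi> X)\<^sup>2\<bar>)
    \<le> (\<Sum>i\<in>I. (\<theta> i - \<phi> i)\<^sup>2) / (2 * \<eta>) + 2 * \<eta>"
proof -
  let ?a = "root_weight I \<theta>" and ?b = "root_weight I \<phi>"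
  \<comment> \<open>AM-GM replaces the usual Cauchy-Schwarz step from Hellinger to total variation distance.\<close>
  have "\<bar>a\<^sup>2 - b\<^sup>2\<bar> \<le> (a\<^sup>2 + b\<^sup>2 - 2 * (a * b)) / (2 * \<eta>) + \<eta> * (a\<^sup>2 + b\<^sup>2)" for a b :: real
  proof -
    have "\<bar>a\<^sup>2 - b\<^sup>2\<bar> = \<bar>a - b\<bar> * \<bar>a + b\<bar>"
      by (simp add: abs_mult[symmetric] power2_eq_square algebra_simps)
    also have "\<dots> \<le> (a - b)\<^sup>2 / (2 * \<eta>) + \<eta> * (a + b)\<^sup>2 / 2"
    proof -
      have "0 \<le> (\<bar>a - b\<bar> - \<eta> * \<bar>a + b\<bar>)\<^sup>2 / (2 * \<eta>)" using assms(2) by simp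
      also have "\<dots> = (a - b)\<^sup>2 / (2 * \<eta>) + \<eta> * (a + b)\<^sup>2 / 2 - \<bar>a - b\<bar> * \<bar>a + b\<bar>"
        using assms(2) by (simp add: power2_diff power_mult_distrib field_simps)
          (simp add: power2_eq_square algebra_simps)
      finally show ?thesis by simp
    qed
    also have "(a + b)\<^sup>2 \<le> 2 * (a\<^sup>2 + b\<^sup>2)"
      using zero_le_power2[of "a - b"] by (simp add: power2_sum power2_diff)
    finally have "\<bar>a\<^sup>2 - b\<^sup>2\<bar> \<le> (a - b)\<^sup>2 / (2 * \<eta>) + \<eta> * (2 * (a\<^sup>2 + b\<^sup>2)) / 2"
      using assms(2) by simp
    moreover have "\<eta> * (2 * (a\<^sup>2 + b\<^sup>2)) / 2 = \<eta> * (a\<^sup>2 + b\<^sup>2)" by simp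
    moreover have "(a - b)\<^sup>2 = a\<^sup>2 + b\<^sup>2 - 2 * (a * b)" by (simp add: power2_diff)
    ultimately show ?thesis by metis
  qed
  then have "(\<Sum>X\<in>Pow I. \<bar>(?a X)\<^sup>2 - (?b X)\<^sup>2\<bar>)
      \<le> (\<Sum>X\<in>Pow I. ((?a X)\<^sup>2 + (?b X)\<^sup>2 - 2 * (?a X * ?b X)) / (2 * \<eta>) + \<eta> * ((?a X)\<^sup>2 + (?b X)\<^sup>2))"
    by (intro sum_mono)
  also have "\<dots> = (1 + 1 - 2 * (\<Prod>i\<in>I. cos (\<theta> i - \<phi> i))) / (2 * \<eta>) + \<eta> * (1 + 1)"
    using sum_root_weight_square[OF assms(1)] sum_root_weight_mult[OF assms(1), of \<theta> \<phi>]
    by (simp add: sum.distrib sum_subtractf sum_distrib_left[symmetric] sum_divide_distrib[symmetric])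
  also have "\<dots> = 2 * (1 - (\<Prod>i\<in>I. cos (\<theta> i - \<phi> i))) / (2 * \<eta>) + 2 * \<eta>" by simp
  \<comment> \<open>Two angles in \<open>{0..pi/2}\<close> differ by at most \<open>pi/2\<close>, so
    all factors lie in \<open>[0, 1]\<close>.\<close>
  also have "1 - (\<Prod>i\<in>I. cos (\<theta> i - \<phi> i)) \<le> (\<Sum>i\<in>I. 1 - cos (\<theta> i - \<phi> i))"
  proof (rule one_minus_prod_le_sum[OF assms(1)])
    fix i assume "i \<in> I"
    from assms(3,4)[OF this] show "0 \<le> cos (\<theta> i - \<phi> i)" by (intro cos_ge_zero) auto
  qed simp
  also have "\<dots> \<le> (\<Sum>i\<in>I. (\<theta> i - \<phi> i)\<^sup>2 / 2)" by (intro sum_mono one_minus_cos_le)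
  finally show ?thesis
    using assms(2) by (simp add: sum_divide_distrib[symmetric] divide_right_mono)
qed

section \<open>Discretising the probabilities to integer levels\<close>

definition level :: "nat \<Rightarrow> nat set \<Rightarrow> (nat \<Rightarrow> real) \<Rightarrow> nat set \<Rightarrow> nat" where
  "level L I \<theta> X = nat \<lfloor>real L * (root_weight I \<theta> X)\<^sup>2\<rfloor>"

lemma level_bounds:
  "real (level L I \<theta> X) \<le> real L * (root_weight I \<theta> X)\<^sup>2"
  "real L * (root_weight I \<theta> X)\<^sup>2 < real (level L I \<theta> X) + 1"
  unfolding level_def by (simp_all add: of_nat_nat)

text \<open>Rounding down loses at most 1 for each of the \<open>2 ^ card I\<close> subsets, and the
  exact weights sum to \<open>L\<close>.\<close>

lemma sum_level_ge:
  assumes "finite I"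
  shows "(\<Sum>X\<in>Pow I. real (level L I \<theta> X)) \<ge> real L - 2 ^ card I"
proof -
  have "(\<Sum>X\<in>Pow I. real L * (root_weight I \<theta> X)\<^sup>2 - 1) \<le> (\<Sum>X\<in>Pow I. real (level L I \<theta> X))"
    using level_bounds(2) by (intro sum_mono) (simp add: less_imp_le algebra_simps)
  then show ?thesis
    using assms sum_root_weight_square[OF assms, of \<theta>]
    by (simp add: sum_subtractf sum_distrib_left[symmetric] card_Pow)
qed

lemma root_weight_square_le_1:
  assumes "finite I" "X \<subseteq> I"
  shows "(root_weight I \<theta> X)\<^sup>2 \<le> 1"
proof -
  have "(root_weight I \<theta> X)\<^sup>2 \<le> (\<Sum>X\<in>Pow I. (root_weight I \<theta> X)\<^sup>2)"
    using assms by (intro member_le_sum) auto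
  then show ?thesis using sum_root_weight_square[OF assms(1)] by simp
qed

text \<open>With \<open>L\<close> this large, rounding adds at most \<open>\<eta> * L\<close> to the
  sum of the level differences and leaves a total weight of at least \<open>L / 2\<close>. The
  mismatch is then at most twice the total variation sum plus \<open>2 * \<eta>\<close>, and that
  sum contributes the remaining \<open>4 * \<eta>\<close>.\<close>

lemma prob_pick_level_neq_le:
  assumes "finite I" "0 < \<eta>" "\<eta> \<le> 1/2" "2 ^ card I \<le> \<eta> * real L"
    and "\<And>i. i \<in> I \<Longrightarrow> \<theta> i \<in> {0..pi/2}" "\<And>i. i \<in> I \<Longrightarrow> \<phi> i \<in> {0..pi/2}"
  shows "measure_pmf.prob (rank_seed (subgraph_code I (\<lambda>_. L)))
      {r. pick I (level L I \<theta>) r \<noteq> pick I (level L I \<phi>) r}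
    \<le> (\<Sum>i\<in>I. (\<theta> i - \<phi> i)\<^sup>2) / \<eta> + 6 * \<eta>"
proof -
  let ?w = "level L I \<theta>" and ?w' = "level L I \<phi>"
  let ?\<Delta> = "\<Sum>X\<in>Pow I. \<bar>(root_weight I \<theta> X)\<^sup>2 - (root_weight I \<phi> X)\<^sup>2\<bar>"
  have "0 < \<eta> * real L" by (rule less_le_trans[OF _ assms(4)]) simp
  then have L: "real L > 0" using assms(2) by (simp add: zero_less_mult_iff)
  have "\<eta> * real L \<le> 1/2 * real L" using assms(3) L by (intro mult_right_mono) auto
  then have half: "(\<Sum>X\<in>Pow I. real (level L I \<psi> X)) \<ge> real L / 2" for \<psi>
    using sum_level_ge[OF assms(1), of L \<psi>] assms(4) by simp
  have pos: "(\<Sum>X\<in>Pow I. level L I \<psi> X) > 0" for \<psi>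
  proof -
    have "0 < real (\<Sum>X\<in>Pow I. level L I \<psi> X)" using half[of \<psi>] L by simp
    then show ?thesis by (simp only: of_nat_0_less_iff)
  qed
  have "real L * (root_weight I \<psi> X)\<^sup>2 \<le> real L" if "X \<subseteq> I" for X \<psi>
    using root_weight_square_le_1[OF assms(1) that] by (intro mult_left_le) auto
  then have "real (level L I \<psi> X) \<le> real L" if "X \<subseteq> I" for X \<psi>
    using that by (intro order_trans[OF level_bounds(1)])
  then have leL: "level L I \<psi> X \<le> L" if "X \<subseteq> I" for X \<psi>
    using that by (simp only: of_nat_le_iff)
  have "\<bar>real (?w X) - real (?w' X)\<bar>
      \<le> real L * \<bar>(root_weight I \<theta> X)\<^sup>2 - (root_weight I \<phi> X)\<^sup>2\<bar> + 1" for X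
  proof -
    have "real L * \<bar>(root_weight I \<theta> X)\<^sup>2 - (root_weight I \<phi> X)\<^sup>2\<bar>
        = \<bar>real L * (root_weight I \<theta> X)\<^sup>2 - real L * (root_weight I \<phi> X)\<^sup>2\<bar>"
      by (simp add: abs_mult right_diff_distrib[symmetric])
    then show ?thesis
      using level_bounds[of L I \<theta> X] level_bounds[of L I \<phi> X] by linarith
  qed
  then have "(\<Sum>X\<in>Pow I. \<bar>real (?w X) - real (?w' X)\<bar>)
      \<le> (\<Sum>X\<in>Pow I. real L * \<bar>(root_weight I \<theta> X)\<^sup>2 - (root_weight I \<phi> X)\<^sup>2\<bar> + 1)"
    by (intro sum_mono)
  also have "\<dots> = real L * ?\<Delta> + 2 ^ card I"
    using assms(1) by (simp add: sum.distrib sum_distrib_left card_Pow)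
  also have "\<dots> \<le> real L * (?\<Delta> + \<eta>)" using assms(4) by (simp add: algebra_simps)
  finally have num: "(\<Sum>X\<in>Pow I. \<bar>real (?w X) - real (?w' X)\<bar>) \<le> real L * (?\<Delta> + \<eta>)" .
  have "measure_pmf.prob (rank_seed (subgraph_code I (\<lambda>_. L))) {r. pick I ?w r \<noteq> pick I ?w' r}
      \<le> (\<Sum>X\<in>Pow I. \<bar>real (?w X) - real (?w' X)\<bar>) / (\<Sum>X\<in>Pow I. real (?w X))"
    using pos leL by (intro prob_pick_neq_le assms(1))
  also have "\<dots> \<le> (real L * (?\<Delta> + \<eta>)) / (real L / 2)"
  proof (rule frac_le)
    have "0 \<le> (\<Sum>X\<in>Pow I. \<bar>real (?w X) - real (?w' X)\<bar>)" by (intro sum_nonneg) simp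
    then show "0 \<le> real L * (?\<Delta> + \<eta>)" using num by (rule order_trans)
  qed (use num half L in simp_all)
  also have "\<dots> = 2 * ?\<Delta> + 2 * \<eta>" using L by (simp add: field_simps)
  also have "\<dots> \<le> 2 * ((\<Sum>i\<in>I. (\<theta> i - \<phi> i)\<^sup>2) / (2 * \<eta>) + 2 * \<eta>) + 2 * \<eta>"
  proof -
    have "?\<Delta> \<le> (\<Sum>i\<in>I. (\<theta> i - \<phi> i)\<^sup>2) / (2 * \<eta>) + 2 * \<eta>"
      by (rule sum_abs_root_weight_diff_le) (use assms in auto)
    then show ?thesis by (intro add_right_mono mult_left_mono) simp_all
  qed
  finally show ?thesis by simp
qed

section \<open>From estimates to angles, and the resulting rounding scheme\<close>

definition clamp_angle :: "real \<Rightarrow> real \<Rightarrow> real \<Rightarrow> real" where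
  "clamp_angle lo hi x = pi / 2 * max 0 (min 1 ((x - lo) / (hi - lo)))"

lemma clamp_angle_bounds: "clamp_angle lo hi x \<in> {0..pi/2}"
  unfolding clamp_angle_def using mult_left_mono[of "max 0 (min 1 ((x - lo) / (hi - lo)))" 1 "pi/2"]
  by auto

text \<open>Clamping is 1-Lipschitz, and the slope \<open>pi / 2\<close> is rounded up to 2.\<close>

lemma clamp_angle_diff_square_le:
  assumes "lo < hi"
  shows "(clamp_angle lo hi x - clamp_angle lo hi y)\<^sup>2 \<le> 4 * (x - y)\<^sup>2 / (hi - lo)\<^sup>2"
proof -
  define u v where "u = (x - lo) / (hi - lo)" and "v = (y - lo) / (hi - lo)"
  have "clamp_angle lo hi x - clamp_angle lo hi y = pi / 2 * (max 0 (min 1 u) - max 0 (min 1 v))"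
    unfolding clamp_angle_def u_def v_def by (rule right_diff_distrib[symmetric])
  then have "\<bar>clamp_angle lo hi x - clamp_angle lo hi y\<bar> = pi / 2 * \<bar>max 0 (min 1 u) - max 0 (min 1 v)\<bar>"
    by (simp only: abs_mult) simp
  also have "\<dots> \<le> 2 * \<bar>u - v\<bar>"
  proof (rule mult_mono)
    show "\<bar>max 0 (min 1 u) - max 0 (min 1 v)\<bar> \<le> \<bar>u - v\<bar>" by linarith
  qed (use pi_less_4 in auto)
  also have "\<dots> = \<bar>2 * (u - v)\<bar>" by (simp only: abs_mult abs_numeral)
  finally have "(clamp_angle lo hi x - clamp_angle lo hi y)\<^sup>2 \<le> (2 * (u - v))\<^sup>2"
    by (simp only: abs_le_square_iff)
  also have "u - v = (x - y) / (hi - lo)"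
    unfolding u_def v_def by (simp add: diff_divide_distrib[symmetric])
  finally show ?thesis by (simp only: power_mult_distrib power_divide) simp
qed

lemma replicable_rounding:
  assumes "finite (I :: nat set)" "lo < hi" "0 < \<rho>" "\<rho> < 1"
  obtains R :: "(nat \<Rightarrow> real) pmf" and rnd where
    "\<And>x r. rnd x r \<subseteq> I"
    "\<And>x r i. x i \<le> lo \<Longrightarrow> i \<notin> rnd x r"
    "\<And>x r i. i \<in> I \<Longrightarrow> hi \<le> x i \<Longrightarrow> i \<in> rnd x r"
    "\<And>x y. measure_pmf.prob R {r. rnd x r \<noteq> rnd y r}
       \<le> 48 / (\<rho> * (hi - lo)\<^sup>2) * (\<Sum>i\<in>I. (x i - y i)\<^sup>2) + \<rho> / 2"
proof -
  \<comment> \<open>Makes \<open>6 * \<eta>\<close> equal to \<open>\<rho> / 2\<close>; dividing the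
    Lipschitz factor 4 by \<open>\<eta>\<close> yields the constant 48.\<close>
  define \<eta> where "\<eta> = \<rho> / 12"
  have \<eta>: "0 < \<eta>" "\<eta> \<le> 1/2" using assms by (auto simp: \<eta>_def)
  obtain L :: nat where "2 ^ card I / \<eta> \<le> real L" using real_arch_simple by blast
  then have L: "2 ^ card I \<le> \<eta> * real L" using \<eta> by (simp add: field_simps)
  define \<theta> where "\<theta> x i = clamp_angle lo hi (x i)" for x :: "nat \<Rightarrow> real" and i
  define rnd where "rnd x = pick I (level L I (\<theta> x))" for x
  have range: "\<theta> x i \<in> {0..pi/2}" for x i unfolding \<theta>_def by (rule clamp_angle_bounds)
  have "0 < \<eta> * real L" by (rule less_le_trans[OF _ L]) simp
  then have L0: "real L > 0" using \<eta> by (simp add: zero_less_mult_iff)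
  have "\<eta> * real L \<le> 1/2 * real L" using \<eta>(2) by (rule mult_right_mono) simp
  then have pos: "0 < real (\<Sum>X\<in>Pow I. level L I \<psi> X)" for \<psi>
    using sum_level_ge[OF assms(1), of L \<psi>] L L0 unfolding of_nat_sum by linarith
  then have pos: "0 < (\<Sum>X\<in>Pow I. level L I \<psi> X)" for \<psi> by (simp only: of_nat_0_less_iff)
  show ?thesis
  proof
    show sub: "rnd x r \<subseteq> I" for x r unfolding rnd_def by (rule pick_props(2)[OF assms(1) pos])
    \<comment> \<open>A zero weight has level 0 and is never picked. So no factor of the weight of
      the output vanishes, which forces coins at angle 0 out and coins at angle
      \<open>pi / 2\<close> in, whatever the seed.\<close>
    have nz: "root_weight I (\<theta> x) (rnd x r) \<noteq> 0" for x r
    proof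
      assume "root_weight I (\<theta> x) (rnd x r) = 0"
      then have "level L I (\<theta> x) (rnd x r) = 0" by (simp add: level_def)
      moreover have "0 < level L I (\<theta> x) (rnd x r)"
        unfolding rnd_def by (rule pick_props(3)[OF assms(1) pos])
      ultimately show False by simp
    qed
    have fin: "finite (rnd x r)" for x r using sub assms(1) finite_subset by blast
    show "i \<notin> rnd x r" if "x i \<le> lo" for x r i
    proof
      assume "i \<in> rnd x r"
      moreover have "(x i - lo) / (hi - lo) \<le> 0" using that assms(2) by (simp add: divide_le_0_iff)
      then have "sin (\<theta> x i) = 0" unfolding \<theta>_def clamp_angle_def by (simp add: max_def)
      ultimately have "(\<Prod>i\<in>rnd x r. sin (\<theta> x i)) = 0" using fin by (auto simp: prod_zero_iff)
      then show False using nz[of x r] unfolding root_weight_def by simp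
    qed
    show "i \<in> rnd x r" if "i \<in> I" "hi \<le> x i" for x r i
    proof (rule ccontr)
      assume "i \<notin> rnd x r"
      then have "i \<in> I - rnd x r" using that by simp
      moreover have "(x i - lo) / (hi - lo) \<ge> 1" using that assms(2) by simp
      then have "cos (\<theta> x i) = 0" unfolding \<theta>_def clamp_angle_def by (simp add: min_def)
      ultimately have "(\<Prod>i\<in>I - rnd x r. cos (\<theta> x i)) = 0" using assms(1) by (auto simp: prod_zero_iff)
      then show False using nz[of x r] unfolding root_weight_def by simp
    qed
    show "measure_pmf.prob (rank_seed (subgraph_code I (\<lambda>_. L))) {r. rnd x r \<noteq> rnd y r}
        \<le> 48 / (\<rho> * (hi - lo)\<^sup>2) * (\<Sum>i\<in>I. (x i - y i)\<^sup>2) + \<rho> / 2" for x y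
    proof -
      have "measure_pmf.prob (rank_seed (subgraph_code I (\<lambda>_. L))) {r. rnd x r \<noteq> rnd y r}
          \<le> (\<Sum>i\<in>I. (\<theta> x i - \<theta> y i)\<^sup>2) / \<eta> + 6 * \<eta>"
        unfolding rnd_def by (intro prob_pick_level_neq_le assms(1) \<eta> L range)
      also have "(\<Sum>i\<in>I. (\<theta> x i - \<theta> y i)\<^sup>2) \<le> (\<Sum>i\<in>I. 4 * (x i - y i)\<^sup>2 / (hi - lo)\<^sup>2)"
        unfolding \<theta>_def by (intro sum_mono clamp_angle_diff_square_le assms(2))
      also have "\<dots> = 4 * (\<Sum>i\<in>I. (x i - y i)\<^sup>2) / (hi - lo)\<^sup>2"
        by (simp add: sum_distrib_left sum_divide_distrib)
      finally have "measure_pmf.prob (rank_seed (subgraph_code I (\<lambda>_. L))) {r. rnd x r \<noteq> rnd y r}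
          \<le> 4 * (\<Sum>i\<in>I. (x i - y i)\<^sup>2) / (hi - lo)\<^sup>2 / \<eta> + 6 * \<eta>"
        using \<eta> by (simp add: divide_right_mono)
      also have "\<dots> = 48 / (\<rho> * (hi - lo)\<^sup>2) * (\<Sum>i\<in>I. (x i - y i)\<^sup>2) + \<rho> / 2"
        by (simp add: \<eta>_def)
      finally show ?thesis .
    qed
  qed
qed

section \<open>Concentration of empirical biases\<close>

text \<open>Independence of the samples, by splitting off the first one. The factor depends on the
  index \<open>t\<close> so that indices outside a chosen set can receive the factor 1.\<close>

lemma nn_integral_replicate_pmf_prod:
  fixes f :: "nat \<Rightarrow> 'a \<Rightarrow> ennreal"
  shows "(\<integral>\<^sup>+S. (\<Prod>t<n. f t (S ! t)) \<partial>measure_pmf (replicate_pmf n D)) = (\<Prod>t<n. \<integral>\<^sup>+x. f t x \<partial>D)"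
proof (induction n arbitrary: f)
  case (Suc n)
  have "(\<integral>\<^sup>+S. (\<Prod>t<Suc n. f t (S ! t)) \<partial>replicate_pmf (Suc n) D)
      = (\<integral>\<^sup>+x. \<integral>\<^sup>+S. f 0 x * (\<Prod>t<n. f (Suc t) (S ! t)) \<partial>replicate_pmf n D \<partial>D)"
    by (simp add: nn_integral_bind_pmf prod.lessThan_Suc_shift del: prod.lessThan_Suc)
  also have "\<dots> = (\<integral>\<^sup>+x. f 0 x \<partial>D) * (\<Prod>t<n. \<integral>\<^sup>+x. f (Suc t) x \<partial>D)"
    by (simp add: nn_integral_cmult nn_integral_multc Suc.IH[of "\<lambda>t. f (Suc t)"])
  also have "\<dots> = (\<Prod>t<Suc n. \<integral>\<^sup>+x. f t x \<partial>D)"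
    by (simp add: prod.lessThan_Suc_shift del: prod.lessThan_Suc)
  finally show ?case .
qed simp

section \<open>Exponential and second moments of the deviation of one coin\<close>

definition deviation :: "bool list pmf \<Rightarrow> nat set \<Rightarrow> nat \<Rightarrow> bool list list \<Rightarrow> real" where
  "deviation D T i S = (\<Sum>t\<in>T. of_bool (S ! t ! i) - bias D i)"

text \<open>Hoeffding's lemma for a centred variable with range of length 1.\<close>

lemma mgf_flip_le:
  "(\<integral>\<^sup>+x. exp (l * (of_bool (x ! i) - bias D i)) \<partial>measure_pmf D) \<le> ennreal (exp (l\<^sup>2 / 8))"
proof -
  have p: "measure_pmf.expectation D (\<lambda>x. of_bool (x ! i)) = bias D i"
  proof -
    have "(\<lambda>x. of_bool (x ! i)) = (indicator {x. x ! i} :: bool list \<Rightarrow> real)"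
      by (auto simp: fun_eq_iff indicator_def)
    then show ?thesis by (simp add: bias_def)
  qed
  have int: "integrable (measure_pmf D) (\<lambda>x. of_bool (x ! i) :: real)"
    by (rule measure_pmf.integrable_const_bound[where B = 1]) auto
  \<comment> \<open>The sign of \<open>l\<close> moves into the variable as \<open>s\<close>, so
    that Hoeffding's lemma is applied with the positive parameter \<open>\<bar>l\<bar>\<close>. The
    range starts at \<open>a\<close>, which depends on \<open>s\<close>.\<close>
  have *: "(\<integral>\<^sup>+x. exp (\<bar>l\<bar> * (s * (of_bool (x ! i) - bias D i))) \<partial>measure_pmf D)
      \<le> ennreal (exp (l\<^sup>2 / 8))" if "l \<noteq> 0" "s = 1 \<or> s = -1" for s
  proof -
    define a where "a = (if s = 1 then - bias D i else bias D i - 1)"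
    interpret interval_bounded_random_variable "measure_pmf D"
        "\<lambda>x. s * (of_bool (x ! i) - bias D i)" a "a + 1"
      by unfold_locales (use that in \<open>auto simp: a_def\<close>)
    have "measure_pmf.expectation D (\<lambda>x. s * (of_bool (x ! i) - bias D i)) = 0"
      using int p by simp
    from Hoeffdings_lemma_nn_integral_0[OF _ this, of "\<bar>l\<bar>"] show ?thesis using that by simp
  qed
  show ?thesis
  proof (cases "l = 0")
    case False
    have "\<bar>l\<bar> * (sgn l * c) = l * c" for c :: real
      unfolding mult.assoc[symmetric] abs_mult_sgn ..
    moreover have "sgn l = 1 \<or> sgn l = -1" using False by (simp add: sgn_if)
    ultimately show ?thesis using *[OF False, of "sgn l"] by (simp only:)
  qed simp
qed

lemma mgf_deviation_le:
  assumes "T \<subseteq> {..<n}"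
  shows "(\<integral>\<^sup>+S. exp (l * deviation D T i S) \<partial>measure_pmf (replicate_pmf n D)) \<le> ennreal (exp (l\<^sup>2 * real (card T) / 8))"
proof -
  define e where "e x = ennreal (exp (l * (of_bool (x ! i) - bias D i)))" for x
  have prod_T: "(\<Prod>t<n. if t \<in> T then h t else 1) = (\<Prod>t\<in>T. h t)" for h :: "nat \<Rightarrow> ennreal"
    using assms by (simp add: prod.If_cases Int_absorb1)
  have "ennreal (exp (l * deviation D T i S)) = (\<Prod>t<n. (if t \<in> T then e (S ! t) else 1))" for S
    unfolding prod_T e_def deviation_def using finite_subset[OF assms]
    by (simp add: sum_distrib_left exp_sum prod_ennreal)
  then have "(\<integral>\<^sup>+S. exp (l * deviation D T i S) \<partial>measure_pmf (replicate_pmf n D))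
      = (\<Prod>t<n. \<integral>\<^sup>+x. (if t \<in> T then e x else 1) \<partial>D)"
    using nn_integral_replicate_pmf_prod[where f = "\<lambda>t x. if t \<in> T then e x else 1"] by simp
  also have "\<dots> = (\<Prod>t<n. if t \<in> T then (\<integral>\<^sup>+x. e x \<partial>D) else 1)"
    by (intro prod.cong) auto
  also have "\<dots> = (\<integral>\<^sup>+x. e x \<partial>D) ^ card T" unfolding prod_T by simp
  also have "\<dots> \<le> ennreal (exp (l\<^sup>2 / 8)) ^ card T"
    unfolding e_def by (intro power_mono mgf_flip_le) simp
  also have "\<dots> = ennreal (exp (l\<^sup>2 * real (card T) / 8))"
    by (simp add: ennreal_power exp_of_nat_mult[symmetric] mult.commute)
  finally show ?thesis .
qed

text \<open>The even function of the deviation dominates both tails at once and also, up to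
  constants, its square.\<close>

lemma mgf_deviation_two_sided_le:
  assumes "T \<subseteq> {..<n}"
  shows "(\<integral>\<^sup>+S. ennreal (exp (l * deviation D T i S) + exp (- l * deviation D T i S)) \<partial>measure_pmf (replicate_pmf n D))
    \<le> ennreal (2 * exp (l\<^sup>2 * real (card T) / 8))"
proof -
  have "(\<integral>\<^sup>+S. ennreal (exp (l * deviation D T i S) + exp (- l * deviation D T i S)) \<partial>measure_pmf (replicate_pmf n D))
      = (\<integral>\<^sup>+S. exp (l * deviation D T i S) \<partial>measure_pmf (replicate_pmf n D))
        + (\<integral>\<^sup>+S. exp (- l * deviation D T i S) \<partial>measure_pmf (replicate_pmf n D))"
    by (subst nn_integral_add[symmetric]) auto
  also have "\<dots> \<le> ennreal (exp (l\<^sup>2 * real (card T) / 8)) + ennreal (exp ((- l)\<^sup>2 * real (card T) / 8))"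
    by (intro add_mono mgf_deviation_le assms)
  finally show ?thesis by (simp flip: ennreal_plus)
qed

lemma prob_deviation_ge_le:
  fixes \<tau> :: real
  assumes "T \<subseteq> {..<n}" "\<tau> \<ge> 0"
  shows "measure_pmf.prob (replicate_pmf n D) {S. \<bar>deviation D T i S\<bar> \<ge> card T * \<tau>}
    \<le> 2 * exp (- 2 * card T * \<tau>\<^sup>2)"
proof -
  \<comment> \<open>Chernoff's method: \<open>l = 4 * \<tau>\<close> minimises the exponent
    \<open>l\<^sup>2 * card T / 8 - l * card T * \<tau>\<close>.\<close>
  let ?X = "deviation D T i" and ?B = "{S. \<bar>deviation D T i S\<bar> \<ge> card T * \<tau>}" and ?l = "4 * \<tau>"
  let ?c = "exp (- ?l * (card T * \<tau>))"
  have "emeasure (replicate_pmf n D) ?B = (\<integral>\<^sup>+S. indicator ?B S \<partial>measure_pmf (replicate_pmf n D))" by simp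
  also have "\<dots> \<le> (\<integral>\<^sup>+S. ennreal ?c * ennreal (exp (?l * ?X S) + exp (- ?l * ?X S)) \<partial>measure_pmf (replicate_pmf n D))"
  proof (rule nn_integral_mono)
    fix S
    show "indicator ?B S \<le> ennreal ?c * ennreal (exp (?l * ?X S) + exp (- ?l * ?X S))"
    proof (cases "S \<in> ?B")
      case True
      then have "?l * (card T * \<tau>) \<le> ?l * \<bar>?X S\<bar>" using assms(2) by (intro mult_left_mono) auto
      then have "exp (?l * (card T * \<tau>)) \<le> exp (?l * \<bar>?X S\<bar>)" by simp
      also have "\<dots> \<le> exp (?l * ?X S) + exp (- ?l * ?X S)" by (cases "?X S \<ge> 0") auto
      finally have "?c * exp (?l * (card T * \<tau>)) \<le> ?c * (exp (?l * ?X S) + exp (- ?l * ?X S))"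
        by (intro mult_left_mono) auto
      then have "1 \<le> ?c * (exp (?l * ?X S) + exp (- ?l * ?X S))"
        by (simp add: exp_add[symmetric])
      then have "ennreal 1 \<le> ennreal (?c * (exp (?l * ?X S) + exp (- ?l * ?X S)))"
        by (rule ennreal_leI)
      also have "\<dots> = ennreal ?c * ennreal (exp (?l * ?X S) + exp (- ?l * ?X S))"
        by (rule ennreal_mult) (auto intro: add_nonneg_nonneg)
      finally show ?thesis using True by (simp del: ennreal_plus)
    qed simp
  qed
  also have "\<dots> \<le> ennreal ?c * ennreal (2 * exp (?l\<^sup>2 * real (card T) / 8))"
  proof (subst nn_integral_cmult)
    show "ennreal ?c * (\<integral>\<^sup>+S. ennreal (exp (?l * ?X S) + exp (- ?l * ?X S)) \<partial>measure_pmf (replicate_pmf n D))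
        \<le> ennreal ?c * ennreal (2 * exp (?l\<^sup>2 * card T / 8))"
      by (intro mult_left_mono mgf_deviation_two_sided_le assms(1)) simp
  qed simp
  also have "\<dots> = ennreal (2 * (?c * exp (?l\<^sup>2 * real (card T) / 8)))"
    by (simp flip: ennreal_mult)
  also have "?c * exp (?l\<^sup>2 * real (card T) / 8) = exp (- 2 * card T * \<tau>\<^sup>2)"
    by (simp add: exp_add[symmetric] power2_eq_square)
  finally show ?thesis by (simp add: measure_pmf.emeasure_eq_measure)
qed

text \<open>The right side minus 2 is the square of \<open>exp (x / 2) - exp (- x / 2)\<close>,
  whose modulus is at least \<open>\<bar>x / 2\<bar>\<close>.\<close>

lemma exp_plus_exp_minus_ge: "x\<^sup>2 / 4 + 2 \<le> exp x + exp (- x)" for x :: real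
proof -
  have "\<bar>x / 2\<bar> \<le> \<bar>exp (x / 2) - exp (- x / 2)\<bar>"
  proof (cases "x \<ge> 0")
    case True
    then have "exp (- x / 2) \<le> 1" by simp
    then show ?thesis using True exp_ge_add_one_self[of "x / 2"] by linarith
  next
    case False
    then have "exp (x / 2) \<le> 1" by simp
    then show ?thesis using False exp_ge_add_one_self[of "- x / 2"] by linarith
  qed
  then have "(x / 2)\<^sup>2 \<le> (exp (x / 2) - exp (- x / 2))\<^sup>2" by (simp only: abs_le_square_iff)
  also have "\<dots> = exp x + exp (- x) - 2"
    by (simp only: power2_diff) (simp add: power2_eq_square mult.assoc exp_add[symmetric])
  finally show ?thesis by (simp add: power_divide)
qed

text \<open>Read off from the moment generating function at \<open>l = (8 / card T)\<^sup>1\<^sup>/\<^sup>2\<close>.\<close>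
lemma second_moment_deviation_le:
  assumes "T \<subseteq> {..<n}" "T \<noteq> {}"
  shows "(\<integral>\<^sup>+S. ennreal ((deviation D T i S)\<^sup>2) \<partial>measure_pmf (replicate_pmf n D)) \<le> ennreal (2 * real (card T))"
proof -
  let ?X = "deviation D T i" and ?P = "measure_pmf (replicate_pmf n D)"
  define l where "l = sqrt (8 / real (card T))"
  have m: "card T > 0" using assms finite_subset card_gt_0_iff by blast
  then have l2: "l\<^sup>2 = 8 / real (card T)" by (simp add: l_def)
  have "ennreal (2 / real (card T)) * (\<integral>\<^sup>+S. ennreal ((?X S)\<^sup>2) \<partial>?P) + 2
      = (\<integral>\<^sup>+S. ennreal (2 / real (card T) * (?X S)\<^sup>2 + 2) \<partial>?P)"
    by (simp add: nn_integral_add ennreal_mult nn_integral_cmult[symmetric] del: times_divide_eq_left)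
  also have "\<dots> \<le> (\<integral>\<^sup>+S. ennreal (exp (l * ?X S) + exp (- l * ?X S)) \<partial>?P)"
  proof (intro nn_integral_mono ennreal_leI)
    fix S show "2 / real (card T) * (?X S)\<^sup>2 + 2 \<le> exp (l * ?X S) + exp (- l * ?X S)"
      using exp_plus_exp_minus_ge[of "l * ?X S"] by (simp add: power_mult_distrib l2)
  qed
  also have "\<dots> \<le> ennreal (2 * exp (l\<^sup>2 * real (card T) / 8))"
    by (rule mgf_deviation_two_sided_le[OF assms(1)])
  \<comment> \<open>At this \<open>l\<close> the exponent is 1, and \<open>exp 1 \<le> 3\<close>.
    The summand 2 then cancels on both sides.\<close>
  also have "\<dots> \<le> ennreal (4 + 2)" using exp_le m by (intro ennreal_leI) (simp add: l2)
  also have "\<dots> = ennreal 4 + 2" by (subst ennreal_plus) simp_all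
  finally have "2 + ennreal (2 / real (card T)) * (\<integral>\<^sup>+S. ennreal ((?X S)\<^sup>2) \<partial>?P) \<le> 2 + ennreal 4"
    by (simp only: add.commute)
  then have "ennreal (2 / real (card T)) * (\<integral>\<^sup>+S. ennreal ((?X S)\<^sup>2) \<partial>?P) \<le> ennreal 4"
    by (simp only: ennreal_add_left_cancel_le) simp
  then have "ennreal (real (card T) / 2) * (ennreal (2 / real (card T)) * (\<integral>\<^sup>+S. ennreal ((?X S)\<^sup>2) \<partial>?P))
      \<le> ennreal (real (card T) / 2) * ennreal 4"
    by (rule mult_left_mono) simp
  also have "ennreal (real (card T) / 2) * ennreal 4 = ennreal (2 * real (card T))"
    by (subst ennreal_mult[symmetric]) simp_all
  finally show ?thesis using m by (simp add: mult.assoc[symmetric] flip: ennreal_mult)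
qed

section \<open>The algorithms\<close>

text \<open>
  Both models use the empirical mean of coin \<open>i\<close> over a set \<open>T i\<close> of \<open>m\<close> of the \<open>M\<close> samples. Samples of
  coin \<open>i\<close> and coin \<open>j\<close> may be arbitrarily dependent; only linearity of expectation is used across coins.
\<close>
locale coin_estimator =
  fixes N m M :: nat and T :: "nat \<Rightarrow> nat set" and est :: "bool list list \<Rightarrow> nat \<Rightarrow> real"
  assumes m_pos: "m > 0"
    and T_subset: "i < N \<Longrightarrow> T i \<subseteq> {..<M}"
    and card_T: "i < N \<Longrightarrow> card (T i) = m"
    and est: "i < N \<Longrightarrow> length S = M \<Longrightarrow> est S i = (\<Sum>t\<in>T i. of_bool (S ! t ! i)) / m"
begin

section \<open>Accuracy of the estimate of a single coin\<close>

lemma est_minus_bias: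
  assumes "i < N" "S \<in> set_pmf (replicate_pmf M D)"
  shows "est S i - bias D i = deviation D (T i) i S / m"
proof -
  have "length S = M" using assms(2) by (simp add: set_replicate_pmf)
  then show ?thesis
    using assms(1) m_pos by (simp add: est card_T deviation_def sum_subtractf field_simps)
qed

lemma prob_est_far_le:
  assumes "i < N" "\<tau> \<ge> 0"
  shows "measure_pmf.prob (replicate_pmf M D) {S. \<bar>est S i - bias D i\<bar> \<ge> \<tau>}
    \<le> 2 * exp (- 2 * real m * \<tau>\<^sup>2)"
proof -
  have "measure_pmf.prob (replicate_pmf M D) {S. \<bar>est S i - bias D i\<bar> \<ge> \<tau>}
      \<le> measure_pmf.prob (replicate_pmf M D) {S. \<bar>deviation D (T i) i S\<bar> \<ge> card (T i) * \<tau>}"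
  proof (intro measure_pmf.finite_measure_mono_AE)
    show "AE S in measure_pmf (replicate_pmf M D). S \<in> {S. \<bar>est S i - bias D i\<bar> \<ge> \<tau>} \<longrightarrow>
        S \<in> {S. \<bar>deviation D (T i) i S\<bar> \<ge> card (T i) * \<tau>}"
      using assms(1) m_pos
      by (auto simp: AE_measure_pmf_iff est_minus_bias card_T field_simps)
  qed simp
  also have "\<dots> \<le> 2 * exp (- 2 * real m * \<tau>\<^sup>2)"
    using prob_deviation_ge_le[OF T_subset[OF assms(1)] assms(2), where i = i and D = D] card_T[OF assms(1)] by simp
  finally show ?thesis .
qed

lemma mean_square_est_le:
  assumes "i < N"
  shows "(\<integral>\<^sup>+S. ennreal ((est S i - bias D i)\<^sup>2) \<partial>measure_pmf (replicate_pmf M D)) \<le> ennreal (2 / real m)"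
proof -
  let ?P = "measure_pmf (replicate_pmf M D)"
  have "T i \<noteq> {}" using card_T[OF assms] m_pos by auto
  have "(\<integral>\<^sup>+S. ennreal ((est S i - bias D i)\<^sup>2) \<partial>?P)
      = (\<integral>\<^sup>+S. ennreal (1 / (real m)\<^sup>2) * ennreal ((deviation D (T i) i S)\<^sup>2) \<partial>?P)"
    by (intro nn_integral_cong_AE)
      (simp add: AE_measure_pmf_iff est_minus_bias assms power_divide flip: ennreal_mult)
  also have "\<dots> = ennreal (1 / (real m)\<^sup>2) * (\<integral>\<^sup>+S. ennreal ((deviation D (T i) i S)\<^sup>2) \<partial>?P)"
    by (rule nn_integral_cmult) simp
  also have "\<dots> \<le> ennreal (1 / (real m)\<^sup>2) * ennreal (2 * real m)"
    using second_moment_deviation_le[OF T_subset[OF assms] \<open>T i \<noteq> {}\<close>, where i = i and D = D] card_T[OF assms]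
    by (intro mult_left_mono) auto
  also have "\<dots> = ennreal (2 / real m)"
    using m_pos by (simp add: power2_eq_square flip: ennreal_mult)
  finally show ?thesis .
qed

text \<open>For any seed, an error at coin \<open>i\<close> forces its estimate to be off by at
  least a quarter of the gap. The error event is thus covered by an event about the samples alone,
  and a union bound over the coins applies.\<close>

lemma solves_coin_problem_rounding:
  fixes R :: "'r pmf"
  assumes "p\<^sub>0 < q\<^sub>0" "0 < \<delta>"
    and m: "real m > 8 * ln (2 * real N / \<delta>) / (q\<^sub>0 - p\<^sub>0)\<^sup>2"
    and rnd: "\<And>x r. rnd x r \<subseteq> {..<N}"
      "\<And>x r i. x i \<le> p\<^sub>0 + (q\<^sub>0 - p\<^sub>0) / 4 \<Longrightarrow> i \<notin> rnd x r"
      "\<And>x r i. i \<in> {..<N} \<Longrightarrow> q\<^sub>0 - (q\<^sub>0 - p\<^sub>0) / 4 \<le> x i \<Longrightarrow> i \<in> rnd x r"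
    and "N > 0"
  shows "solves_coin_problem N p\<^sub>0 q\<^sub>0 \<delta> M (measure_pmf R) (\<lambda>r S. rnd (est S) r)"
  unfolding solves_coin_problem_def
proof (intro allI impI)
  fix D :: "bool list pmf"
  let ?P = "measure_pmf (replicate_pmf M D)" and ?\<tau> = "(q\<^sub>0 - p\<^sub>0) / 4"
  define B where "B i = {S. \<bar>est S i - bias D i\<bar> \<ge> ?\<tau>}" for i
  let ?E = "{(r, S) \<in> space (measure_pmf R \<Otimes>\<^sub>M ?P). coin_error N p\<^sub>0 q\<^sub>0 D (rnd (est S) r)}"
  interpret pair_prob_space "measure_pmf R" ?P ..
  have "measure (measure_pmf R \<Otimes>\<^sub>M ?P) ?E \<le> measure (measure_pmf R \<Otimes>\<^sub>M ?P) (UNIV \<times> (\<Union>i<N. B i))"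
  proof (rule finite_measure_mono)
    show "?E \<subseteq> UNIV \<times> (\<Union>i<N. B i)"
    proof (rule subsetI)
      fix z assume "z \<in> ?E"
      then obtain r S where z: "z = (r, S)" and "coin_error N p\<^sub>0 q\<^sub>0 D (rnd (est S) r)" by auto
      from this(2) obtain i where i: "i < N" and
        e: "bias D i \<le> p\<^sub>0 \<and> i \<in> rnd (est S) r \<or> bias D i \<ge> q\<^sub>0 \<and> i \<notin> rnd (est S) r"
        unfolding coin_error_def by blast
      have "S \<in> B i"
      proof (rule ccontr)
        assume "S \<notin> B i"
        then have "\<bar>est S i - bias D i\<bar> < ?\<tau>" unfolding B_def by simp
        then have "bias D i \<le> p\<^sub>0 \<Longrightarrow> est S i \<le> p\<^sub>0 + ?\<tau>" "q\<^sub>0 \<le> bias D i \<Longrightarrow> q\<^sub>0 - ?\<tau> \<le> est S i"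
          by linarith+
        then show False using e i rnd(2)[of "est S" i r] rnd(3)[of i "est S" r] by blast
      qed
      with i show "z \<in> UNIV \<times> (\<Union>i<N. B i)" unfolding z by blast
    qed
  qed (auto intro!: pair_measureI)
  also have "\<dots> = measure ?P (\<Union>i<N. B i)"
    by (simp add: measure_def measure_pmf.emeasure_pair_measure_Times measure_pmf.emeasure_space_1[of R, simplified])
  also have "\<dots> \<le> (\<Sum>i<N. measure ?P (B i))"
    by (rule measure_pmf.finite_measure_subadditive_finite) auto
  also have "\<dots> \<le> (\<Sum>i<N. 2 * exp (- 2 * real m * ?\<tau>\<^sup>2))"
    unfolding B_def using assms(1) by (intro sum_mono prob_est_far_le) auto
  also have "\<dots> = 2 * real N * exp (- 2 * real m * ?\<tau>\<^sup>2)" by simp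
  also have "\<dots> < 2 * real N * exp (- ln (2 * real N / \<delta>))"
  proof -
    \<comment> \<open>With \<open>?\<tau>\<close> a quarter of the gap, the right side is
      \<open>m\<close> times the squared gap over 8. The strict bound on \<open>m\<close> is what
      makes the failure probability strictly less than \<open>\<delta>\<close>.\<close>
    have "ln (2 * real N / \<delta>) < 2 * real m * ?\<tau>\<^sup>2"
      using m assms(1) by (simp add: power_divide field_simps)
    then have "exp (- 2 * real m * ?\<tau>\<^sup>2) < exp (- ln (2 * real N / \<delta>))" by simp
    then show ?thesis using \<open>N > 0\<close> by (intro mult_strict_left_mono) auto
  qed
  also have "\<dots> = \<delta>"
    using \<open>N > 0\<close> assms(2) by (simp add: exp_minus)
  finally show "measure (measure_pmf R \<Otimes>\<^sub>M ?P) ?E < \<delta>" .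
qed

text \<open>Fix both samples, average over the seed first, and then over the samples. Comparing both
  estimates with the true biases splits the expected squared distance, and each half contributes at
  most \<open>\<rho> / 4\<close>; the offset \<open>\<rho> / 2\<close> completes
  \<open>\<rho>\<close>.\<close>

lemma replicable_rounding_samples:
  fixes R :: "'r pmf"
  assumes va: "vector_algorithm N (measure_pmf R) (\<lambda>r S. rnd (est S) r)"
    and "c \<ge> 0" "0 < \<rho>" and m: "real m \<ge> 16 * c * real N / \<rho>"
    and le: "\<And>x y. measure_pmf.prob R {r. rnd x r \<noteq> rnd y r}
       \<le> c * (\<Sum>i<N. (x i - y i)\<^sup>2) + \<rho> / 2"
  shows "replicable N \<rho> M (measure_pmf R) (\<lambda>r S. rnd (est S) r)"
  unfolding replicable_def
proof (intro allI impI)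
  fix D :: "bool list pmf"
  let ?P = "measure_pmf (replicate_pmf M D)"
  let ?Q = "measure_pmf R \<Otimes>\<^sub>M (?P \<Otimes>\<^sub>M ?P)"
  let ?E = "{(r, S, S') \<in> space ?Q. rnd (est S) r = rnd (est S') r}"
  interpret PP: pair_prob_space ?P ?P ..
  interpret Q: pair_prob_space "measure_pmf R" "?P \<Otimes>\<^sub>M ?P" ..
  have E: "?E \<in> sets ?Q"
    using vector_algorithm_events(2)[OF va, of "replicate_pmf M D" "replicate_pmf M D"] by simp
  define u where "u S = ennreal (2 * c * (\<Sum>i<N. (est S i - bias D i)\<^sup>2))" for S
  have u: "(\<integral>\<^sup>+S. u S \<partial>?P) \<le> ennreal (\<rho> / 4)"
  proof -
    have "(\<integral>\<^sup>+S. u S \<partial>?P)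
        = (\<integral>\<^sup>+S. ennreal (2 * c) * (\<Sum>i<N. ennreal ((est S i - bias D i)\<^sup>2)) \<partial>?P)"
      unfolding u_def using \<open>c \<ge> 0\<close> by (simp add: ennreal_mult sum_nonneg)
    also have "\<dots> = ennreal (2 * c) * (\<Sum>i<N. \<integral>\<^sup>+S. ennreal ((est S i - bias D i)\<^sup>2) \<partial>?P)"
      by (subst nn_integral_cmult) (simp_all add: nn_integral_sum del: sum_ennreal)
    also have "\<dots> \<le> ennreal (2 * c) * (\<Sum>i<N. ennreal (2 / real m))"
      by (intro mult_left_mono sum_mono mean_square_est_le) auto
    also have "\<dots> = ennreal (2 * c * (real N * (2 / real m)))"
      using \<open>c \<ge> 0\<close> by (subst sum_ennreal) (simp_all flip: ennreal_mult)
    \<comment> \<open>The left side is \<open>4 * c * N / m\<close>, which is where the factor 16 in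
      the bound on \<open>m\<close> comes from.\<close>
    also have "\<dots> \<le> ennreal (\<rho> / 4)"
      using m m_pos \<open>0 < \<rho>\<close> by (intro ennreal_leI) (simp add: field_simps)
    finally show ?thesis .
  qed
  have fst_u: "(\<integral>\<^sup>+y. u (fst y) \<partial>(?P \<Otimes>\<^sub>M ?P)) = (\<integral>\<^sup>+S. u S \<partial>?P)"
    by (subst measure_pmf.nn_integral_fst[symmetric])
      (auto intro!: measurable_compose[OF measurable_fst] simp: measure_pmf.emeasure_space_1[simplified])
  have snd_u: "(\<integral>\<^sup>+y. u (snd y) \<partial>(?P \<Otimes>\<^sub>M ?P)) = (\<integral>\<^sup>+S. u S \<partial>?P)"
    by (subst measure_pmf.nn_integral_fst[symmetric])
      (auto intro!: measurable_compose[OF measurable_snd] simp: measure_pmf.emeasure_space_1[simplified])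
  have "emeasure ?Q (space ?Q - ?E) = (\<integral>\<^sup>+y. emeasure (measure_pmf R) ((\<lambda>r. (r, y)) -` (space ?Q - ?E)) \<partial>(?P \<Otimes>\<^sub>M ?P))"
    by (intro Q.emeasure_pair_measure_alt2 sets.compl_sets E)
  also have "\<dots> \<le> (\<integral>\<^sup>+y. u (fst y) + u (snd y) + ennreal (\<rho> / 2) \<partial>(?P \<Otimes>\<^sub>M ?P))"
  proof (rule nn_integral_mono)
    fix y :: "bool list list \<times> bool list list"
    obtain S S' where y: "y = (S, S')" by (cases y)
    have "emeasure (measure_pmf R) ((\<lambda>r. (r, y)) -` (space ?Q - ?E)) = measure_pmf.prob R {r. rnd (est S) r \<noteq> rnd (est S') r}"
      by (simp add: measure_pmf.emeasure_eq_measure y space_pair_measure vimage_def)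
    also have "\<dots> \<le> ennreal (c * (\<Sum>i<N. (est S i - est S' i)\<^sup>2) + \<rho> / 2)"
      by (intro ennreal_leI le)
    also have "\<dots> \<le> ennreal (2 * c * (\<Sum>i<N. (est S i - bias D i)\<^sup>2)
        + 2 * c * (\<Sum>i<N. (est S' i - bias D i)\<^sup>2) + \<rho> / 2)"
    proof (intro ennreal_leI add_right_mono)
      have "(a - b)\<^sup>2 \<le> 2 * (a - p)\<^sup>2 + 2 * (b - p)\<^sup>2" for a b p :: real
        using zero_le_power2[of "(a - p) + (b - p)"] by (simp add: power2_eq_square algebra_simps)
      then have "(\<Sum>i<N. (est S i - est S' i)\<^sup>2)
          \<le> (\<Sum>i<N. 2 * (est S i - bias D i)\<^sup>2 + 2 * (est S' i - bias D i)\<^sup>2)"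
        by (intro sum_mono)
      from mult_left_mono[OF this \<open>c \<ge> 0\<close>]
      show "c * (\<Sum>i<N. (est S i - est S' i)\<^sup>2) \<le> 2 * c * (\<Sum>i<N. (est S i - bias D i)\<^sup>2)
        + 2 * c * (\<Sum>i<N. (est S' i - bias D i)\<^sup>2)"
        by (simp add: sum.distrib sum_distrib_left[symmetric] algebra_simps)
    qed
    also have "\<dots> = u (fst y) + u (snd y) + ennreal (\<rho> / 2)"
      unfolding u_def y using \<open>c \<ge> 0\<close> \<open>0 < \<rho>\<close> by (simp add: sum_nonneg)
    finally show "emeasure (measure_pmf R) ((\<lambda>r. (r, y)) -` (space ?Q - ?E)) \<le> u (fst y) + u (snd y) + ennreal (\<rho> / 2)" .
  qed
  also have "\<dots> = (\<integral>\<^sup>+S. u S \<partial>?P) + (\<integral>\<^sup>+S. u S \<partial>?P) + ennreal (\<rho> / 2)"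
  proof -
    have "(\<lambda>y. u (fst y)) \<in> borel_measurable (?P \<Otimes>\<^sub>M ?P)" "(\<lambda>y. u (snd y)) \<in> borel_measurable (?P \<Otimes>\<^sub>M ?P)"
      by (auto intro: measurable_compose[OF measurable_fst] measurable_compose[OF measurable_snd])
    then show ?thesis by (simp add: nn_integral_add fst_u snd_u PP.P.emeasure_space_1)
  qed
  also have "\<dots> \<le> ennreal (\<rho> / 4) + ennreal (\<rho> / 4) + ennreal (\<rho> / 2)"
    by (intro add_mono u order_refl)
  also have "\<dots> = ennreal \<rho>" using \<open>0 < \<rho>\<close> by (simp flip: ennreal_plus)
  finally have "measure ?Q (space ?Q - ?E) \<le> \<rho>"
    using \<open>0 < \<rho>\<close> by (simp add: Q.P.emeasure_eq_measure)
  then show "measure ?Q ?E \<ge> 1 - \<rho>"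
    using Q.P.prob_compl[OF E] by simp
qed

end

text \<open>The query rule looks only at the length of the history, so the coin flipped at each time
  is known in advance. The initial history \<open>h\<close> is arbitrary to let the induction go
  through.\<close>

lemma coordinate_flips_round_robin:
  "coordinate_flips (\<lambda>h. length h mod N) h S
     = h @ map (\<lambda>t. S ! t ! ((length h + t) mod N)) [0..<length S]"
proof (induction S arbitrary: h)
  case (Cons x S)
  show ?case
    by (simp add: Cons.IH upt_conv_Cons map_Suc_upt[symmetric] del: upt_Suc)
qed simp

theorem corollary4p45:
  shows "\<exists>C>0. \<forall>(N::nat) (p\<^sub>0::real) (q\<^sub>0::real) (\<delta>::real) (\<rho>::real).
    N \<ge> 1 \<longrightarrow> 0 \<le> p\<^sub>0 \<longrightarrow> p\<^sub>0 < q\<^sub>0 \<longrightarrow> q\<^sub>0 \<le> 1 \<longrightarrow>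
    0 < \<delta> \<longrightarrow> \<delta> < \<rho> \<longrightarrow> \<rho> < 1 \<longrightarrow> \<delta> < 1 / 2 \<longrightarrow>
      (\<exists>(m::nat) (R :: (nat \<Rightarrow> real) measure) A.
         vector_algorithm N R A \<and>
         solves_coin_problem N p\<^sub>0 q\<^sub>0 \<delta> m R A \<and>
         replicable N \<rho> m R A \<and>
         real m \<le> C * (real N / ((q\<^sub>0 - p\<^sub>0)\<^sup>2 * \<rho>\<^sup>2) * (ln (real N / \<delta>)) ^ 3)) \<and>
      (\<exists>(m::nat) (R :: (nat \<Rightarrow> real) measure) q f.
         coordinate_algorithm N R q f \<and>
         solves_coin_problem N p\<^sub>0 q\<^sub>0 \<delta> m R (coordinate_run q f) \<and>
         replicable N \<rho> m R (coordinate_run q f) \<and>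
         real m \<le> C * ((real N)\<^sup>2 / ((q\<^sub>0 - p\<^sub>0)\<^sup>2 * \<rho>\<^sup>2) * (ln (real N / \<delta>)) ^ 3))"
proof (intro exI[of _ "24584::real"] conjI allI impI)
  fix N :: nat and p\<^sub>0 q\<^sub>0 \<delta> \<rho> :: real
  assume N: "N \<ge> 1" and p: "0 \<le> p\<^sub>0" "p\<^sub>0 < q\<^sub>0" "q\<^sub>0 \<le> 1"
    and \<delta>: "0 < \<delta>" and \<rho>: "\<delta> < \<rho>" "\<rho> < 1" and \<delta>2: "\<delta> < 1 / 2"

  \<comment> \<open>The sample size and its lower bounds\<close>
  define \<epsilon> l x where "\<epsilon> = q\<^sub>0 - p\<^sub>0" and "l = ln (real N / \<delta>)" and "x = real N / (\<epsilon>\<^sup>2 * \<rho>\<^sup>2)"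
  \<comment> \<open>Replicability needs \<open>m \<ge> 3072 * x\<close>. As \<open>l ^ 3 \<ge> 1 / 8\<close>, it suffices to take \<open>8 * 3072 = 24576\<close>, and
    rounding up costs at most another \<open>8\<close>.\<close>
  define m where "m = nat \<lceil>24576 * (x * l ^ 3)\<rceil>"
  have \<epsilon>: "0 < \<epsilon>" "\<epsilon> \<le> 1" and "0 < \<rho>" using p \<delta> \<rho> by (auto simp: \<epsilon>_def)
  have "1 / 2 \<le> ln (2 :: real)" using ln2_ge_two_thirds by simp
  \<comment> \<open>Here \<open>\<delta> < 1 / 2\<close> keeps the logarithm \<open>l\<close> away
    from 0, so that its cube can absorb constants and a linear term.\<close>
  have "2 * \<delta> \<le> real N * 1" using \<delta>2 N by linarith
  then have "2 \<le> real N / \<delta>" using \<delta> by (simp add: field_simps)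
  then have "ln 2 \<le> l" unfolding l_def by simp
  with \<open>1 / 2 \<le> ln 2\<close> have l: "1 / 2 \<le> l" by linarith
  have "\<rho>\<^sup>2 \<le> 1" using \<rho> \<open>0 < \<rho>\<close> by (simp add: power_le_one)
  have "\<epsilon>\<^sup>2 \<le> 1" using \<epsilon> by (simp add: power_le_one)
  have "\<epsilon>\<^sup>2 * \<rho>\<^sup>2 \<le> \<epsilon>\<^sup>2" using \<open>\<rho>\<^sup>2 \<le> 1\<close> by (simp add: mult_left_le)
  then have x: "1 / \<epsilon>\<^sup>2 \<le> x" unfolding x_def using N \<epsilon> \<open>0 < \<rho>\<close> by (intro frac_le) auto
  have "1 \<le> 1 / \<epsilon>\<^sup>2" using \<epsilon> \<open>\<epsilon>\<^sup>2 \<le> 1\<close> by simp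
  with x have x1: "1 \<le> x" by linarith
  have l2: "1 / 4 \<le> l\<^sup>2" using power_mono[OF l, of 2] by (simp add: power_divide)
  have l3: "l / 4 \<le> l ^ 3"
    using mult_left_mono[OF l2, of l] l by (simp add: power2_eq_square power3_eq_cube mult_ac)
  have m_ge: "24576 * (x * l ^ 3) \<le> real m" unfolding m_def by (rule real_nat_ceiling_ge)
  have xl8: "x * (1 / 8) \<le> x * l ^ 3" using l3 l x1 by (intro mult_left_mono) auto
  have "0 \<le> x * l ^ 3" using xl8 x1 by linarith
  then have "real m \<le> 24576 * (x * l ^ 3) + 1" unfolding m_def by linarith
  then have m_le: "real m \<le> 24584 * (x * l ^ 3)" using xl8 x1 by linarith
  have m1: "3072 * x \<le> real m" using m_ge xl8 by linarith
  have m_pos: "m > 0" using m1 x1 by linarith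
  have "x * (l / 4) \<le> x * l ^ 3" using l3 x1 by (intro mult_left_mono) auto
  then have "6144 * (x * l) \<le> real m" using m_ge by linarith
  moreover have "1 / \<epsilon>\<^sup>2 * l \<le> x * l" using x l by (intro mult_right_mono) auto
  moreover have "0 < 1 / \<epsilon>\<^sup>2 * l" using \<epsilon> l by (intro mult_pos_pos) auto
  \<comment> \<open>Correctness needs more than this quantity, hence at most
    \<open>16 * l / \<epsilon>\<^sup>2\<close>; the available \<open>6144 * (x * l)\<close> exceeds
    it strictly since \<open>l\<close> is positive.\<close>
  moreover have "8 * ln (2 * real N / \<delta>) / \<epsilon>\<^sup>2 \<le> 16 * (1 / \<epsilon>\<^sup>2 * l)"
  proof -
    have "ln (2 * real N / \<delta>) = ln 2 + l"
      using N \<delta> ln_mult[of 2 "real N / \<delta>"] by (simp add: l_def)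
    then have "8 * ln (2 * real N / \<delta>) \<le> 16 * l" using \<open>ln 2 \<le> l\<close> by linarith
    from divide_right_mono[OF this, of "\<epsilon>\<^sup>2"] show ?thesis by simp
  qed
  ultimately have m2: "8 * ln (2 * real N / \<delta>) / (q\<^sub>0 - p\<^sub>0)\<^sup>2 < real m"
    unfolding \<epsilon>_def[symmetric] by linarith
  \<comment> \<open>The rounding ramp fills the middle half of the gap and leaves a quarter on each
    side for estimation error.\<close>
  define lo hi where "lo = p\<^sub>0 + (q\<^sub>0 - p\<^sub>0) / 4" and "hi = q\<^sub>0 - (q\<^sub>0 - p\<^sub>0) / 4"
  have "lo < hi" using p by (simp add: lo_def hi_def field_simps)
  have hl: "hi - lo = \<epsilon> / 2" by (simp add: lo_def hi_def \<epsilon>_def field_simps)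
  obtain R :: "(nat \<Rightarrow> real) pmf" and rnd where
    rnd: "\<And>x r. rnd x r \<subseteq> {..<N}"
      "\<And>x r i. x i \<le> lo \<Longrightarrow> i \<notin> rnd x r"
      "\<And>x r i. i \<in> {..<N} \<Longrightarrow> hi \<le> x i \<Longrightarrow> i \<in> rnd x r"
    and rnd_close: "\<And>x y. measure_pmf.prob R {r. rnd x r \<noteq> rnd y r}
       \<le> 48 / (\<rho> * (hi - lo)\<^sup>2) * (\<Sum>i<N. (x i - y i)\<^sup>2) + \<rho> / 2"
    by (rule replicable_rounding[OF finite_lessThan \<open>lo < hi\<close> \<open>0 < \<rho>\<close> \<open>\<rho> < 1\<close>, of N]) (rule that)
  \<comment> \<open>As \<open>hi - lo\<close> is \<open>\<epsilon> / 2\<close>, the left side equals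
    \<open>16 * 48 * 4 * x\<close>, that is \<open>3072 * x\<close>.\<close>
  have m3: "16 * (48 / (\<rho> * (hi - lo)\<^sup>2)) * real N / \<rho> \<le> real m"
    using m1 unfolding hl x_def by (simp add: power_divide power2_eq_square mult_ac)
  have correct: "vector_algorithm N (measure_pmf R) (\<lambda>r S. rnd (est S) r)"
    "solves_coin_problem N p\<^sub>0 q\<^sub>0 \<delta> M (measure_pmf R) (\<lambda>r S. rnd (est S) r)"
    "replicable N \<rho> M (measure_pmf R) (\<lambda>r S. rnd (est S) r)"
    if "coin_estimator N m M T est" for M T est
  proof -
    interpret coin_estimator N m M T est by (fact that)
    show va: "vector_algorithm N (measure_pmf R) (\<lambda>r S. rnd (est S) r)"
      unfolding vector_algorithm_def using rnd(1) measure_pmf.prob_space_axioms by auto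
    show "solves_coin_problem N p\<^sub>0 q\<^sub>0 \<delta> M (measure_pmf R) (\<lambda>r S. rnd (est S) r)"
      using N by (intro solves_coin_problem_rounding p \<delta> m2 rnd[unfolded lo_def hi_def]) auto
    show "replicable N \<rho> M (measure_pmf R) (\<lambda>r S. rnd (est S) r)"
      using \<open>0 < \<rho>\<close> by (intro replicable_rounding_samples[OF va _ _ m3 rnd_close]) auto
  qed

  \<comment> \<open>The vector model: every coin uses all \<open>m\<close> samples\<close>
  have "coin_estimator N m m (\<lambda>_. {..<m}) (\<lambda>S i. (\<Sum>t<m. of_bool (S ! t ! i)) / m)"
    using m_pos by unfold_locales auto
  note vector = correct[OF this]
  show "\<exists>(m::nat) (R :: (nat \<Rightarrow> real) measure) A.
         vector_algorithm N R A \<and>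
         solves_coin_problem N p\<^sub>0 q\<^sub>0 \<delta> m R A \<and>
         replicable N \<rho> m R A \<and>
         real m \<le> 24584 * (real N / ((q\<^sub>0 - p\<^sub>0)\<^sup>2 * \<rho>\<^sup>2) * (ln (real N / \<delta>)) ^ 3)"
    by (intro exI conjI) (rule vector m_le[unfolded x_def l_def \<epsilon>_def])+

  \<comment> \<open>The coordinate model: coins are flipped in turn\<close>
  define q :: "(nat \<Rightarrow> real) \<Rightarrow> bool list \<Rightarrow> nat" where "q r h = length h mod N" for r h
  \<comment> \<open>The \<open>m\<close> times at which the round robin flips coin \<open>i\<close>,
    among the first \<open>N * m\<close>.\<close>
  define T where "T i = (\<lambda>j. j * N + i) ` {..<m}" for i
  define f where "f r h = rnd (\<lambda>i. (\<Sum>t\<in>T i. of_bool (h ! t)) / m) r" for r and h :: "bool list"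
  \<comment> \<open>The estimate computed by \<open>f\<close> from the observed flips alone, written
    as a function of the underlying samples so that the common analysis applies.\<close>
  define est where "est S i = (\<Sum>t\<in>T i. of_bool (coordinate_flips (\<lambda>h. length h mod N) [] S ! t)) / real m"
    for S i
  have T: "t < N * m \<and> t mod N = i" if i: "i < N" and t: "t \<in> T i" for i t
  proof -
    obtain j where j: "j < m" "t = j * N + i" using t unfolding T_def by blast
    then have "t < (j + 1) * N" using i by simp
    also have "\<dots> \<le> m * N" using j by (intro mult_right_mono) auto
    finally show ?thesis using j i by (simp add: mult.commute)
  qed
  have "coin_estimator N m (N * m) T est"
  proof
    fix i and S :: "bool list list" assume i: "i < N"
    show "T i \<subseteq> {..<N * m}" using T[OF i] by blast
    show "card (T i) = m" unfolding T_def using N by (subst card_image) (auto simp: inj_on_def)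
    assume S: "length S = N * m"
    have "coordinate_flips (\<lambda>h. length h mod N) [] S ! t = S ! t ! i" if "t \<in> T i" for t
      using T[OF i that] S by (simp add: coordinate_flips_round_robin)
    then show "est S i = (\<Sum>t\<in>T i. of_bool (S ! t ! i)) / real m" unfolding est_def by simp
  qed (fact m_pos)
  note coordinate = correct[OF this]
  have run: "coordinate_run q f = (\<lambda>r S. rnd (est S) r)"
    unfolding coordinate_run_def f_def q_def[abs_def] est_def[abs_def] ..
  have "coordinate_algorithm N (measure_pmf R) q f"
    unfolding coordinate_algorithm_def q_def f_def
    using rnd(1) N measure_pmf.prob_space_axioms by auto
  moreover have "real (N * m) \<le> 24584 * ((real N)\<^sup>2 / ((q\<^sub>0 - p\<^sub>0)\<^sup>2 * \<rho>\<^sup>2) * (ln (real N / \<delta>)) ^ 3)"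
    using mult_left_mono[OF m_le, of "real N"] unfolding x_def l_def \<epsilon>_def
    by (simp add: power2_eq_square mult_ac)
  ultimately show "\<exists>(m::nat) (R :: (nat \<Rightarrow> real) measure) q f.
         coordinate_algorithm N R q f \<and>
         solves_coin_problem N p\<^sub>0 q\<^sub>0 \<delta> m R (coordinate_run q f) \<and>
         replicable N \<rho> m R (coordinate_run q f) \<and>
         real m \<le> 24584 * ((real N)\<^sup>2 / ((q\<^sub>0 - p\<^sub>0)\<^sup>2 * \<rho>\<^sup>2) * (ln (real N / \<delta>)) ^ 3)"
    using coordinate(2,3)[folded run] by (intro exI[of _ "N * m"] exI[of _ "measure_pmf R"] exI[of _ q] exI[of _ f] conjI)
qed simp

end
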